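(* Let $K$ be a field, $\sigma$ an automorphism of $K$ with fixed field $F=\mathrm{Fix}(\sigma)$, $R=K[t;\sigma]$, and let $f\in R$ be a monic polynomial of degree $m\ge 2$ which is not right invariant. Write $N=\mathrm{Nuc}(S_f)$. Suppose that $f(t)\in F[t]\subset R$. Then $N[t;\sigma]/N[t;\sigma]f$ is a Petit algebra and an associative subalgebra of $\mathrm{Nuc}_r(S_f)$.
   Context: $R=K[t;\sigma]$ is the twisted polynomial ring: polynomials $\sum b_it^i$ with $b_i\in K$, termwise addition, and multiplication determined by $ta=\sigma(a)t$ for $a\in K$. $f$ is right invariant if $Rf$ is a two-sided ideal of $R$. The Petit algebra $S_f=K[t;\sigma]/K[t;\sigma]f$ is the unital nonassociative $F$-algebra with underlying additive group $\{g\in R:\deg g<m\}$ and multiplication $g\circ h=gh\,\mathrm{mod}_r f$, the remainder of $gh$ under right division by $f$. Left, middle and right nucleus are $\mathrm{Nuc}_l(S_f)=\{x:(xy)z=x(yz)\ \forall y,z\}$, $\mathrm{Nuc}_m(S_f)=\{x:(yx)z=y(xz)\ \forall y,z\}$, $\mathrm{Nuc}_r(S_f)=\{x:(yz)x=y(zx)\ \forall y,z\}$, and $\mathrm{Nuc}(S_f)$ is their intersection, which for $f$ not right invariant is a subfield of $K$ of the form $\mathrm{Fix}(\sigma^{j_1})\cap\dots\cap\mathrm{Fix}(\sigma^{j_r})$. In $N[t;\sigma]$ the symbol $\sigma$ stands for the restriction $\sigma|_N$, and $N[t;\sigma]/N[t;\sigma]f$ is the Petit algebra formed in the same way from $N[t;\sigma|_N]$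 and $f$: its elements are the polynomials of degree $<m$ with coefficients in $N$, multiplied modulo right division by $f$; it is viewed as a subset of $S_f$. *)

theory Defs
  imports "HOL-Algebra.Algebra"
begin

text \<open>
  The ring \<open>K[t;\<sigma>]\<close>. Only the multiplication of the polynomial ring is changed: \<open>t a = \<sigma>(a) t\<close>
  forces \<open>(a t\<^sup>i) (b t\<^sup>j) = a \<sigma>\<^sup>i(b) t\<^sup>i\<^sup>+\<^sup>j\<close>. Everything below takes the coefficient field as a
  parameter, so that \<open>N[t;\<sigma>]\<close> for a subfield \<open>N\<close> of \<open>K\<close> is literally the same construction for
  \<open>K\<lparr>carrier := N\<rparr>\<close>, and its elements are also elements of \<open>K[t;\<sigma>]\<close>.
\<close>

definition twisted_UP :: "('a, 'b) ring_scheme \<Rightarrow> ('a \<Rightarrow> 'a) \<Rightarrow> ('a, nat \<Rightarrow> 'a) up_ring" where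
  "twisted_UP K \<sigma> = (UP K)\<lparr>mult :=
     (\<lambda>p\<in>up K. \<lambda>q\<in>up K. \<lambda>n. \<Oplus>\<^bsub>K\<^esub>i\<in>{..n}. p i \<otimes>\<^bsub>K\<^esub> (\<sigma> ^^ i) (q (n - i)))\<rparr>"

definition Fix :: "('a, 'b) ring_scheme \<Rightarrow> ('a \<Rightarrow> 'a) \<Rightarrow> 'a set" where
  "Fix K \<sigma> = {a \<in> carrier K. \<sigma> a = a}"

text \<open>\<open>PIdl\<^bsub>R\<^esub> f\<close> is \<open>{x f | x \<in> R}\<close>, i.e. the left ideal \<open>R f\<close>, also when \<open>R\<close> is not commutative.\<close>

definition right_invariant :: "('a, 'b) ring_scheme \<Rightarrow> ('a \<Rightarrow> 'a) \<Rightarrow> (nat \<Rightarrow> 'a) \<Rightarrow> bool" where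
  "right_invariant K \<sigma> f \<longleftrightarrow> ideal (PIdl\<^bsub>twisted_UP K \<sigma>\<^esub> f) (twisted_UP K \<sigma>)"

text \<open>
  The remainder of \<open>g = q f + r\<close>. Since \<open>deg K \<zero> = 0\<close>, the condition \<open>deg K r < deg K f\<close> has its
  usual meaning (with \<open>deg 0 = -\<infinity>\<close>) whenever \<open>f\<close> has positive degree.
\<close>

definition rmod :: "('a, 'b) ring_scheme \<Rightarrow> ('a \<Rightarrow> 'a) \<Rightarrow> (nat \<Rightarrow> 'a) \<Rightarrow> (nat \<Rightarrow> 'a) \<Rightarrow> nat \<Rightarrow> 'a" where
  "rmod K \<sigma> f g = (let R = twisted_UP K \<sigma> in
     THE r. r \<in> carrier R \<and> deg K r < deg K f \<and> (\<exists>q\<in>carrier R. g = q \<otimes>\<^bsub>R\<^esub> f \<oplus>\<^bsub>R\<^esub> r))"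

definition petit_algebra :: "('a, 'b) ring_scheme \<Rightarrow> ('a \<Rightarrow> 'a) \<Rightarrow> (nat \<Rightarrow> 'a) \<Rightarrow> ('a, nat \<Rightarrow> 'a) up_ring" where
  "petit_algebra K \<sigma> f = (let R = twisted_UP K \<sigma> in
     R\<lparr>carrier := {g \<in> carrier R. deg K g < deg K f},
       mult := (\<lambda>g h. rmod K \<sigma> f (g \<otimes>\<^bsub>R\<^esub> h))\<rparr>)"

text \<open>The data for which \<open>petit_algebra K \<sigma> f\<close> is a Petit algebra.\<close>

definition petit_data :: "('a, 'b) ring_scheme \<Rightarrow> ('a \<Rightarrow> 'a) \<Rightarrow> (nat \<Rightarrow> 'a) \<Rightarrow> bool" where
  "petit_data K \<sigma> f \<longleftrightarrow> field K \<and> \<sigma> \<in> ring_iso K K \<and>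
     f \<in> carrier (twisted_UP K \<sigma>) \<and> coeff (UP K) f (deg K f) = \<one>\<^bsub>K\<^esub> \<and> 2 \<le> deg K f"

definition nuc_l :: "('a, 'b) monoid_scheme \<Rightarrow> 'a set" where
  "nuc_l A = {x \<in> carrier A. \<forall>y\<in>carrier A. \<forall>z\<in>carrier A.
     (x \<otimes>\<^bsub>A\<^esub> y) \<otimes>\<^bsub>A\<^esub> z = x \<otimes>\<^bsub>A\<^esub> (y \<otimes>\<^bsub>A\<^esub> z)}"

definition nuc_m :: "('a, 'b) monoid_scheme \<Rightarrow> 'a set" where
  "nuc_m A = {x \<in> carrier A. \<forall>y\<in>carrier A. \<forall>z\<in>carrier A.
     (y \<otimes>\<^bsub>A\<^esub> x) \<otimes>\<^bsub>A\<^esub> z = y \<otimes>\<^bsub>A\<^esub> (x \<otimes>\<^bsub>A\<^esub> z)}"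

definition nuc_r :: "('a, 'b) monoid_scheme \<Rightarrow> 'a set" where
  "nuc_r A = {x \<in> carrier A. \<forall>y\<in>carrier A. \<forall>z\<in>carrier A.
     (y \<otimes>\<^bsub>A\<^esub> z) \<otimes>\<^bsub>A\<^esub> x = y \<otimes>\<^bsub>A\<^esub> (z \<otimes>\<^bsub>A\<^esub> x)}"

definition nuc :: "('a, 'b) monoid_scheme \<Rightarrow> 'a set" where
  "nuc A = nuc_l A \<inter> nuc_m A \<inter> nuc_r A"

text \<open>
  The nucleus of \<open>S\<^sub>f\<close> as a subset of \<open>K\<close>, where \<open>K\<close> is identified with the constant polynomials.
  If \<open>f\<close> is not right invariant, all elements of the nucleus are constant, so nothing is lost.
\<close>

definition nuc_field :: "('a, 'b) ring_scheme \<Rightarrow> ('a \<Rightarrow> 'a) \<Rightarrow> (nat \<Rightarrow> 'a) \<Rightarrow> 'a set" where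
  "nuc_field K \<sigma> f = {a \<in> carrier K. monom (UP K) a 0 \<in> nuc (petit_algebra K \<sigma> f)}"

text \<open>
  Unital subalgebras over \<open>F\<close> of a not necessarily associative algebra \<open>A\<close>. The subalgebra \<open>B\<close> comes
  with its own operations, which have to be the restrictions of those of \<open>A\<close>.
\<close>

definition is_subalgebra ::
  "('c, 'd) ring_scheme \<Rightarrow> ('c, 'a, 'e) module_scheme \<Rightarrow> ('c, 'a, 'g) module_scheme \<Rightarrow> bool" where
  "is_subalgebra F B A \<longleftrightarrow>
     submodule (carrier B) F A \<and>
     \<one>\<^bsub>A\<^esub> \<in> carrier B \<and>
     (\<forall>x\<in>carrier B. \<forall>y\<in>carrier B. x \<otimes>\<^bsub>A\<^esub> y \<in> carrier B) \<and>
     \<one>\<^bsub>B\<^esub> = \<one>\<^bsub>A\<^esub> \<and> \<zero>\<^bsub>B\<^esub> = \<zero>\<^bsub>A\<^esub> \<and>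
     (\<forall>x\<in>carrier B. \<forall>y\<in>carrier B. x \<otimes>\<^bsub>B\<^esub> y = x \<otimes>\<^bsub>A\<^esub> y \<and> x \<oplus>\<^bsub>B\<^esub> y = x \<oplus>\<^bsub>A\<^esub> y) \<and>
     (\<forall>a\<in>carrier F. \<forall>x\<in>carrier B. a \<odot>\<^bsub>B\<^esub> x = a \<odot>\<^bsub>A\<^esub> x)"

definition is_associative :: "('a, 'b) monoid_scheme \<Rightarrow> bool" where
  "is_associative A \<longleftrightarrow> (\<forall>x\<in>carrier A. \<forall>y\<in>carrier A. \<forall>z\<in>carrier A.
     (x \<otimes>\<^bsub>A\<^esub> y) \<otimes>\<^bsub>A\<^esub> z = x \<otimes>\<^bsub>A\<^esub> (y \<otimes>\<^bsub>A\<^esub> z))"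

end

theory Submission
  imports Defs
begin

text \<open>
  Write \<open>f = \<Sum> f\<^sub>i t\<^sup>i\<close> with all \<open>f\<^sub>i\<close> fixed by \<open>\<sigma>\<close>, and \<open>m = deg f\<close>. An element \<open>x\<close> of \<open>S\<^sub>f\<close> lies in the
  right nucleus if and only if \<open>f x \<in> R f\<close> (\<open>idealizer_imp_nuc_r\<close>, \<open>nuc_r_imp_idealizer\<close>), and a
  constant always lies in the other two nuclei. Applied to constants this gives
  \<open>N = {a. \<forall>i. f\<^sub>i \<sigma>\<^sup>i(a) = \<sigma>\<^sup>m(a) f\<^sub>i}\<close> (\<open>nuc_field_eq\<close>), so \<open>N\<close> is the set where the powers \<open>\<sigma>\<^sup>i\<close> with
  \<open>f\<^sub>i \<noteq> 0\<close> all agree with \<open>\<sigma>\<^sup>m\<close>. In this form it is evident that \<open>N\<close> is a subfield which contains \<open>F\<close>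
  and hence the coefficients of \<open>f\<close>, and that \<open>\<sigma>(N) = N\<close>; so \<open>N\<close>, \<open>\<sigma>|\<^sub>N\<close> and \<open>f\<close> define a Petit algebra.

  For a polynomial \<open>x\<close> with coefficients in \<open>N\<close>, the same conditions say that \<open>f x = x' f\<close>, where \<open>x'\<close>
  arises from \<open>x\<close> by applying \<open>\<sigma>\<^sup>m\<close> to its coefficients (\<open>semicommute_with_f\<close>). Hence \<open>f x \<in> R f\<close>, and
  \<open>x\<close> lies in the right nucleus as soon as its degree is below \<open>m\<close>. The two Petit multiplications agree
  on such \<open>x\<close>, because remainders computed over \<open>N\<close> are remainders over \<open>K\<close> (\<open>rmod_N\<close>). A set of
  elements of the right nucleus that is closed under multiplication is associative.
\<close>

section \<open>The twisted polynomial ring\<close>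

lemma carrier_twisted_UP: "carrier (twisted_UP K \<sigma>) = up K"
  by (simp add: twisted_UP_def UP_def)

lemma twisted_UP_add: "p \<in> up K \<Longrightarrow> q \<in> up K \<Longrightarrow> p \<oplus>\<^bsub>twisted_UP K \<sigma>\<^esub> q = (\<lambda>n. p n \<oplus>\<^bsub>K\<^esub> q n)"
  by (simp add: twisted_UP_def UP_def)

lemma twisted_UP_mult: "p \<in> up K \<Longrightarrow> q \<in> up K \<Longrightarrow>
    p \<otimes>\<^bsub>twisted_UP K \<sigma>\<^esub> q = (\<lambda>n. \<Oplus>\<^bsub>K\<^esub>i\<in>{..n}. p i \<otimes>\<^bsub>K\<^esub> (\<sigma> ^^ i) (q (n - i)))"
  by (simp add: twisted_UP_def UP_def)

lemma twisted_UP_zero: "\<zero>\<^bsub>twisted_UP K \<sigma>\<^esub> = (\<lambda>n. \<zero>\<^bsub>K\<^esub>)"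
  by (simp add: twisted_UP_def UP_def)

lemma twisted_UP_one: "\<one>\<^bsub>twisted_UP K \<sigma>\<^esub> = (\<lambda>n. if n = 0 then \<one>\<^bsub>K\<^esub> else \<zero>\<^bsub>K\<^esub>)"
  by (simp add: twisted_UP_def UP_def)

lemma twisted_UP_smult: "a \<in> carrier K \<Longrightarrow> p \<in> up K \<Longrightarrow> a \<odot>\<^bsub>twisted_UP K \<sigma>\<^esub> p = (\<lambda>n. a \<otimes>\<^bsub>K\<^esub> p n)"
  by (simp add: twisted_UP_def UP_def)

text \<open>
  Everything about \<open>K[t;\<sigma>]\<close> and about division by monic polynomials holds over an arbitrary ring
  with an endomorphism. This generality lets the same lemmas serve \<open>K\<close> and its subrings.
\<close>

locale twisted_poly = K?: ring K for K (structure) +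
  fixes \<sigma> :: "'a \<Rightarrow> 'a"
  assumes twist_hom: "\<sigma> \<in> ring_hom K K"
begin

abbreviation R where "R \<equiv> twisted_UP K \<sigma>"

lemma twist_pow_hom: "\<sigma> ^^ i \<in> ring_hom K K"
proof (induction i)
  case 0
  show ?case by (auto intro!: ring_hom_memI)
next
  case (Suc i)
  then show ?case using ring_hom_trans[OF Suc twist_hom] by (simp add: comp_def)
qed

lemmas twist_pow_closed [simp] = ring_hom_closed[OF twist_pow_hom]
  and twist_pow_mult = ring_hom_mult[OF twist_pow_hom]
  and twist_pow_add = ring_hom_add[OF twist_pow_hom]
  and twist_pow_one [simp] = ring_hom_one[OF twist_pow_hom]

lemma twist_pow_zero [simp]: "(\<sigma> ^^ i) \<zero> = \<zero>"
  using ring_hom_zero[OF twist_pow_hom ring_axioms ring_axioms] .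

lemma coeff_closed: "p \<in> up K \<Longrightarrow> p n \<in> carrier K"
  by (rule mem_upD)

lemma bounded_coeffs:
  assumes "p \<in> up K"
  obtains d where "\<And>n. n > d \<Longrightarrow> p n = \<zero>"
  using assms bound_upD unfolding bound_def by blast

lemma upI:
  assumes "\<And>n. p n \<in> carrier K" and "\<And>n. n > d \<Longrightarrow> p n = \<zero>"
  shows "p \<in> up K"
  using assms by (intro mem_upI) (auto simp: bound_def)

lemma mult_coeff_above:
  assumes p: "p \<in> up K" and q: "q \<in> up K"
    and d: "\<And>n. n > d \<Longrightarrow> p n = \<zero>" and e: "\<And>n. n > e \<Longrightarrow> q n = \<zero>" and n: "n > d + e"
  shows "(p \<otimes>\<^bsub>R\<^esub> q) n = \<zero>"
proof -
  note [simp] = coeff_closed[OF p] coeff_closed[OF q]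
  have "p i \<otimes> (\<sigma> ^^ i) (q (n - i)) = \<zero>" for i
  proof (cases "i > d")
    case False
    then have "n - i > e" using n by simp
    then show ?thesis using p e by simp
  qed (use q d in simp)
  then show ?thesis using p q by (simp add: twisted_UP_mult)
qed

lemma mult_coeff_top:
  assumes p: "p \<in> up K" and q: "q \<in> up K"
    and d: "\<And>n. n > d \<Longrightarrow> p n = \<zero>" and e: "\<And>n. n > e \<Longrightarrow> q n = \<zero>"
  shows "(p \<otimes>\<^bsub>R\<^esub> q) (d + e) = p d \<otimes> (\<sigma> ^^ d) (q e)"
proof -
  note [simp] = coeff_closed[OF p] coeff_closed[OF q]
  have "p i \<otimes> (\<sigma> ^^ i) (q (d + e - i)) = (if i = d then p d \<otimes> (\<sigma> ^^ d) (q e) else \<zero>)"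
    if "i \<le> d + e" for i
  proof (cases "i < d")
    case True
    then show ?thesis using p e[of "d + e - i"] by simp
  next
    case False
    then show ?thesis using p q d[of i] by (cases "i = d") auto
  qed
  then have "(\<Oplus>i\<in>{..d+e}. p i \<otimes> (\<sigma> ^^ i) (q (d + e - i)))
      = (\<Oplus>i\<in>{..d+e}. if i = d then p d \<otimes> (\<sigma> ^^ d) (q e) else \<zero>)"
    using p q by (intro finsum_cong') auto
  also have "\<dots> = p d \<otimes> (\<sigma> ^^ d) (q e)"
    using finsum_singleton[of d "{..d+e}" "\<lambda>_. p d \<otimes> (\<sigma> ^^ d) (q e)"] p q
    by (simp add: Pi_def eq_commute)
  finally show ?thesis using p q by (simp add: twisted_UP_mult)
qed

lemma twisted_mult_closed:
  assumes p: "p \<in> up K" and q: "q \<in> up K"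
  shows "p \<otimes>\<^bsub>R\<^esub> q \<in> up K"
proof -
  note [simp] = coeff_closed[OF p] coeff_closed[OF q]
  obtain d where d: "\<And>n. n > d \<Longrightarrow> p n = \<zero>" using bounded_coeffs[OF p] by blast
  obtain e where e: "\<And>n. n > e \<Longrightarrow> q n = \<zero>" using bounded_coeffs[OF q] by blast
  show ?thesis
  proof (rule upI)
    show "(p \<otimes>\<^bsub>R\<^esub> q) n \<in> carrier K" for n
      using p q by (auto simp: twisted_UP_mult intro!: finsum_closed)
    show "(p \<otimes>\<^bsub>R\<^esub> q) n = \<zero>" if "n > d + e" for n
      using mult_coeff_above[OF p q d e that] .
  qed
qed

text \<open>
  Associativity of the twisted convolution. Both sides sum \<open>a\<^sub>i \<sigma>\<^sup>i(b\<^sub>j) \<sigma>\<^sup>i\<^sup>+\<^sup>j(c\<^sub>l)\<close> over the same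
  triangle of indices, once by \<open>i + j\<close> and once by \<open>i\<close>. Cutting the outer sum off at \<open>k \<le> n\<close>
  makes induction possible: going from \<open>k\<close> to \<open>k + 1\<close> adds the diagonal \<open>i + j = k + 1\<close>, that is,
  one whole summand on the left but one term in each inner sum on the right.
\<close>

lemma twisted_convolution_assoc:
  fixes n :: nat
  assumes a: "\<And>i::nat. a i \<in> carrier K" and b: "\<And>i. b i \<in> carrier K" and c: "\<And>i. c i \<in> carrier K"
    and kn: "k \<le> n"
  shows "(\<Oplus>j\<in>{..k}. (\<Oplus>i\<in>{..j}. a i \<otimes> (\<sigma> ^^ i) (b (j - i))) \<otimes> (\<sigma> ^^ j) (c (n - j)))
       = (\<Oplus>j\<in>{..k}. a j \<otimes> (\<sigma> ^^ j) (\<Oplus>i\<in>{..k - j}. b i \<otimes> (\<sigma> ^^ i) (c (n - j - i))))"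
  using kn
proof (induction k)
  case 0
  show ?case using a b c by (simp add: m_assoc)
next
  case (Suc k)
  let ?c = "(\<sigma> ^^ Suc k) (c (n - Suc k))"
  let ?inner = "\<lambda>k j. \<Oplus>i\<in>{..k - j}. b i \<otimes> (\<sigma> ^^ i) (c (n - j - i))"
  have cc: "?c \<in> carrier K" using c twist_pow_closed by blast
  \<comment> \<open>The new term of the \<open>j\<close>-th inner sum lies on the diagonal \<open>i + j = k + 1\<close>.\<close>
  have step: "a j \<otimes> (\<sigma> ^^ j) (?inner (Suc k) j)
      = a j \<otimes> (\<sigma> ^^ j) (b (Suc k - j)) \<otimes> ?c \<oplus> a j \<otimes> (\<sigma> ^^ j) (?inner k j)" if "j \<le> k" for j
  proof -
    have [simp]: "?inner k j \<in> carrier K" using b c by (auto intro!: finsum_closed)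
    have "n - j - (Suc k - j) = n - Suc k" using that by simp
    then have "(\<sigma> ^^ j) ((\<sigma> ^^ (Suc k - j)) (c (n - j - (Suc k - j)))) = ?c"
      using that by (metis funpow_add comp_apply le_add_diff_inverse le_SucI)
    then have "(\<sigma> ^^ j) (b (Suc k - j) \<otimes> (\<sigma> ^^ (Suc k - j)) (c (n - j - (Suc k - j))))
        = (\<sigma> ^^ j) (b (Suc k - j)) \<otimes> ?c"
      using b c by (simp only: twist_pow_mult twist_pow_closed)
    moreover have "?inner (Suc k) j
        = b (Suc k - j) \<otimes> (\<sigma> ^^ (Suc k - j)) (c (n - j - (Suc k - j))) \<oplus> ?inner k j"
      using that b c by (simp only: Suc_diff_le finsum_Suc Pi_def m_closed twist_pow_closed) auto
    ultimately show ?thesis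
      using a b c cc
      by (simp only: twist_pow_add m_closed twist_pow_closed \<open>?inner k j \<in> carrier K\<close> r_distr m_assoc)
  qed
  have "(\<Oplus>j\<in>{..Suc k}. a j \<otimes> (\<sigma> ^^ j) (?inner (Suc k) j))
      = a (Suc k) \<otimes> (\<sigma> ^^ Suc k) (b 0) \<otimes> ?c
        \<oplus> (\<Oplus>j\<in>{..k}. a j \<otimes> (\<sigma> ^^ j) (?inner (Suc k) j))"
  proof -
    have "a (Suc k) \<otimes> (\<sigma> ^^ Suc k) (?inner (Suc k) (Suc k)) = a (Suc k) \<otimes> (\<sigma> ^^ Suc k) (b 0) \<otimes> ?c"
      using a b c cc twist_pow_mult[of "b 0" "c (n - Suc k)" "Suc k"]
      by (simp del: funpow.simps add: m_assoc)
    moreover have "(\<lambda>j. a j \<otimes> (\<sigma> ^^ j) (?inner (Suc k) j)) \<in> {..Suc k} \<rightarrow> carrier K"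
      using a b c by (auto intro!: m_closed twist_pow_closed finsum_closed)
    ultimately show ?thesis by (simp only: finsum_Suc)
  qed
  also have "(\<Oplus>j\<in>{..k}. a j \<otimes> (\<sigma> ^^ j) (?inner (Suc k) j))
      = (\<Oplus>j\<in>{..k}. a j \<otimes> (\<sigma> ^^ j) (b (Suc k - j)) \<otimes> ?c \<oplus> a j \<otimes> (\<sigma> ^^ j) (?inner k j))"
    using step a b c cc
    by (intro finsum_cong') (auto intro!: m_closed a_closed twist_pow_closed finsum_closed)
  also have "\<dots> = (\<Oplus>j\<in>{..k}. a j \<otimes> (\<sigma> ^^ j) (b (Suc k - j)) \<otimes> ?c)
      \<oplus> (\<Oplus>j\<in>{..k}. a j \<otimes> (\<sigma> ^^ j) (?inner k j))"
    using a b c cc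
    by (intro finsum_addf) (auto intro!: m_closed a_closed twist_pow_closed finsum_closed)
  also have "(\<Oplus>j\<in>{..k}. a j \<otimes> (\<sigma> ^^ j) (?inner k j))
      = (\<Oplus>j\<in>{..k}. (\<Oplus>i\<in>{..j}. a i \<otimes> (\<sigma> ^^ i) (b (j - i))) \<otimes> (\<sigma> ^^ j) (c (n - j)))"
    using Suc by simp
  also have "(\<Oplus>j\<in>{..k}. a j \<otimes> (\<sigma> ^^ j) (b (Suc k - j)) \<otimes> ?c)
      = (\<Oplus>j\<in>{..k}. a j \<otimes> (\<sigma> ^^ j) (b (Suc k - j))) \<otimes> ?c"
    using a b cc by (intro finsum_ldistr[symmetric]) auto
  finally have rhs: "(\<Oplus>j\<in>{..Suc k}. a j \<otimes> (\<sigma> ^^ j) (?inner (Suc k) j))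
    = a (Suc k) \<otimes> (\<sigma> ^^ Suc k) (b 0) \<otimes> ?c
       \<oplus> ((\<Oplus>j\<in>{..k}. a j \<otimes> (\<sigma> ^^ j) (b (Suc k - j))) \<otimes> ?c
       \<oplus> (\<Oplus>j\<in>{..k}. (\<Oplus>i\<in>{..j}. a i \<otimes> (\<sigma> ^^ i) (b (j - i))) \<otimes> (\<sigma> ^^ j) (c (n - j))))" .
  have split: "(\<Oplus>i\<in>{..Suc k}. a i \<otimes> (\<sigma> ^^ i) (b (Suc k - i)))
      = a (Suc k) \<otimes> (\<sigma> ^^ Suc k) (b 0) \<oplus> (\<Oplus>i\<in>{..k}. a i \<otimes> (\<sigma> ^^ i) (b (Suc k - i)))"
    using a b by (subst finsum_Suc) (auto simp del: funpow.simps)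
  have "(\<Oplus>j\<in>{..Suc k}. (\<Oplus>i\<in>{..j}. a i \<otimes> (\<sigma> ^^ i) (b (j - i))) \<otimes> (\<sigma> ^^ j) (c (n - j)))
     = (\<Oplus>i\<in>{..Suc k}. a i \<otimes> (\<sigma> ^^ i) (b (Suc k - i))) \<otimes> ?c
       \<oplus> (\<Oplus>j\<in>{..k}. (\<Oplus>i\<in>{..j}. a i \<otimes> (\<sigma> ^^ i) (b (j - i))) \<otimes> (\<sigma> ^^ j) (c (n - j)))"
    using a b c by (intro finsum_Suc) (auto intro!: m_closed twist_pow_closed finsum_closed)
  also have "\<dots> = a (Suc k) \<otimes> (\<sigma> ^^ Suc k) (b 0) \<otimes> ?c
       \<oplus> ((\<Oplus>j\<in>{..k}. a j \<otimes> (\<sigma> ^^ j) (b (Suc k - j))) \<otimes> ?c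
       \<oplus> (\<Oplus>j\<in>{..k}. (\<Oplus>i\<in>{..j}. a i \<otimes> (\<sigma> ^^ i) (b (j - i))) \<otimes> (\<sigma> ^^ j) (c (n - j))))"
    unfolding split using a b c cc
    by (subst l_distr)
      (auto intro!: m_closed a_closed twist_pow_closed finsum_closed a_assoc simp del: funpow.simps)
  finally show ?case unfolding rhs .
qed

lemma twisted_UP_ring: "ring R"
proof (rule ringI)
  note [simp] = carrier_twisted_UP
  have "add_monoid R = add_monoid (UP K)"
    by (simp add: twisted_UP_def)
  then show "abelian_group R"
    using ring.is_abelian_group[OF UP_ring.UP_ring[OF UP_ring.intro[OF ring_axioms]]]
    by (simp add: abelian_group_def abelian_monoid_def abelian_group_axioms_def)
  show "monoid R"
  proof (rule monoidI)
    show "\<one>\<^bsub>R\<^esub> \<in> carrier R"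
      using up_one_closed by (simp add: twisted_UP_one)
    fix x y z assume xyz: "x \<in> carrier R" "y \<in> carrier R" "z \<in> carrier R"
    show "x \<otimes>\<^bsub>R\<^esub> y \<in> carrier R" using xyz twisted_mult_closed by simp
    show "x \<otimes>\<^bsub>R\<^esub> y \<otimes>\<^bsub>R\<^esub> z = x \<otimes>\<^bsub>R\<^esub> (y \<otimes>\<^bsub>R\<^esub> z)"
    proof
      note [simp] = xyz[simplified, THEN coeff_closed]
      fix n
      have "(x \<otimes>\<^bsub>R\<^esub> y \<otimes>\<^bsub>R\<^esub> z) n
          = (\<Oplus>j\<in>{..n}. (\<Oplus>i\<in>{..j}. x i \<otimes> (\<sigma> ^^ i) (y (j - i))) \<otimes> (\<sigma> ^^ j) (z (n - j)))"
        using xyz twisted_UP_mult[of "x \<otimes>\<^bsub>R\<^esub> y" K z] twisted_mult_closed[of x y] by (simp add: twisted_UP_mult[of x K y])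
      also have "\<dots> = (\<Oplus>j\<in>{..n}. x j \<otimes> (\<sigma> ^^ j) (\<Oplus>i\<in>{..n - j}. y i \<otimes> (\<sigma> ^^ i) (z (n - j - i))))"
        using xyz by (intro twisted_convolution_assoc) auto
      also have "\<dots> = (x \<otimes>\<^bsub>R\<^esub> (y \<otimes>\<^bsub>R\<^esub> z)) n"
        using xyz twisted_UP_mult[of x K "y \<otimes>\<^bsub>R\<^esub> z"] twisted_mult_closed[of y z] by (simp add: twisted_UP_mult[of y K z])
      finally show "(x \<otimes>\<^bsub>R\<^esub> y \<otimes>\<^bsub>R\<^esub> z) n = (x \<otimes>\<^bsub>R\<^esub> (y \<otimes>\<^bsub>R\<^esub> z)) n" .
    qed
  next
    fix x assume x: "x \<in> carrier R"
    note [simp] = x[simplified, THEN coeff_closed]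
    have one: "\<one>\<^bsub>R\<^esub> \<in> up K" using up_one_closed by (simp add: twisted_UP_one)
    show "\<one>\<^bsub>R\<^esub> \<otimes>\<^bsub>R\<^esub> x = x"
    proof
      fix n
      have "(\<one>\<^bsub>R\<^esub> \<otimes>\<^bsub>R\<^esub> x) n = (\<Oplus>i\<in>{..n}. if 0 = i then x (n - i) else \<zero>)"
        using x one by (auto simp: twisted_UP_mult intro!: finsum_cong') (auto simp: twisted_UP_one)
      also have "\<dots> = x n"
        using finsum_singleton[of 0 "{..n}" "\<lambda>i. x (n - i)"] x by (simp add: Pi_def)
      finally show "(\<one>\<^bsub>R\<^esub> \<otimes>\<^bsub>R\<^esub> x) n = x n" .
    qed
    show "x \<otimes>\<^bsub>R\<^esub> \<one>\<^bsub>R\<^esub> = x"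
    proof
      fix n
      have "(x \<otimes>\<^bsub>R\<^esub> \<one>\<^bsub>R\<^esub>) n = (\<Oplus>i\<in>{..n}. if n = i then x i else \<zero>)"
        using x one by (auto simp: twisted_UP_mult intro!: finsum_cong') (auto simp: twisted_UP_one)
      also have "\<dots> = x n"
        using finsum_singleton[of n "{..n}" x] x by (simp add: Pi_def)
      finally show "(x \<otimes>\<^bsub>R\<^esub> \<one>\<^bsub>R\<^esub>) n = x n" .
    qed
  qed
next
  fix x y z assume "x \<in> carrier R" "y \<in> carrier R" "z \<in> carrier R"
  then have xyz: "x \<in> up K" "y \<in> up K" "z \<in> up K" by (simp_all add: carrier_twisted_UP)
  note [simp] = coeff_closed[OF xyz(1)] coeff_closed[OF xyz(2)] coeff_closed[OF xyz(3)]
  have xy: "(\<lambda>n. x n \<oplus> y n) \<in> up K" using xyz up_add_closed by simp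
  show "(x \<oplus>\<^bsub>R\<^esub> y) \<otimes>\<^bsub>R\<^esub> z = x \<otimes>\<^bsub>R\<^esub> z \<oplus>\<^bsub>R\<^esub> y \<otimes>\<^bsub>R\<^esub> z"
  proof
    fix n
    have "((x \<oplus>\<^bsub>R\<^esub> y) \<otimes>\<^bsub>R\<^esub> z) n
        = (\<Oplus>i\<in>{..n}. x i \<otimes> (\<sigma> ^^ i) (z (n - i)) \<oplus> y i \<otimes> (\<sigma> ^^ i) (z (n - i)))"
      using xyz xy by (simp add: twisted_UP_add twisted_UP_mult l_distr)
    also have "\<dots> = (x \<otimes>\<^bsub>R\<^esub> z \<oplus>\<^bsub>R\<^esub> y \<otimes>\<^bsub>R\<^esub> z) n"
      using xyz by (simp only: twisted_UP_add twisted_mult_closed) (simp add: twisted_UP_mult finsum_addf Pi_def)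
    finally show "((x \<oplus>\<^bsub>R\<^esub> y) \<otimes>\<^bsub>R\<^esub> z) n = (x \<otimes>\<^bsub>R\<^esub> z \<oplus>\<^bsub>R\<^esub> y \<otimes>\<^bsub>R\<^esub> z) n" .
  qed
  show "z \<otimes>\<^bsub>R\<^esub> (x \<oplus>\<^bsub>R\<^esub> y) = z \<otimes>\<^bsub>R\<^esub> x \<oplus>\<^bsub>R\<^esub> z \<otimes>\<^bsub>R\<^esub> y"
  proof
    fix n
    have "(z \<otimes>\<^bsub>R\<^esub> (x \<oplus>\<^bsub>R\<^esub> y)) n
        = (\<Oplus>i\<in>{..n}. z i \<otimes> (\<sigma> ^^ i) (x (n - i)) \<oplus> z i \<otimes> (\<sigma> ^^ i) (y (n - i)))"
      using xyz xy by (simp add: twisted_UP_add twisted_UP_mult r_distr twist_pow_add)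
    also have "\<dots> = (z \<otimes>\<^bsub>R\<^esub> x \<oplus>\<^bsub>R\<^esub> z \<otimes>\<^bsub>R\<^esub> y) n"
      using xyz by (simp only: twisted_UP_add twisted_mult_closed) (simp add: twisted_UP_mult finsum_addf Pi_def)
    finally show "(z \<otimes>\<^bsub>R\<^esub> (x \<oplus>\<^bsub>R\<^esub> y)) n = (z \<otimes>\<^bsub>R\<^esub> x \<oplus>\<^bsub>R\<^esub> z \<otimes>\<^bsub>R\<^esub> y) n" .
  qed
qed

end

sublocale twisted_poly \<subseteq> R: ring "twisted_UP K \<sigma>"
  by (rule twisted_UP_ring)

section \<open>Degrees and monomials\<close>

context twisted_poly
begin

text \<open>
  Polynomials are treated as elements of \<open>carrier R\<close> from here on, and their coefficients by plain
  function application.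
\<close>

lemma coeff_in_K [simp]: "p \<in> carrier R \<Longrightarrow> p n \<in> carrier K"
  by (simp add: carrier_twisted_UP coeff_closed)

lemma UP_ring_K: "UP_ring K"
  by unfold_locales

lemma coeff_UP: "p \<in> carrier R \<Longrightarrow> up_ring.coeff (UP K) p = p"
  by (simp add: carrier_twisted_UP UP_def)

lemma coeff_above_deg: "p \<in> carrier R \<Longrightarrow> n > deg K p \<Longrightarrow> p n = \<zero>"
  using UP_ring.deg_aboveD[OF UP_ring_K, of p n] by (simp add: carrier_twisted_UP coeff_UP UP_def)

lemma deg_less_iff:
  assumes "p \<in> carrier R" "0 < m"
  shows "deg K p < m \<longleftrightarrow> (\<forall>n\<ge>m. p n = \<zero>)"
proof
  assume "\<forall>n\<ge>m. p n = \<zero>"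
  then have "deg K p \<le> m - 1"
    using assms UP_ring.deg_aboveI[OF UP_ring_K, of "m - 1" p] by (simp add: carrier_twisted_UP UP_def)
  then show "deg K p < m" using assms by simp
next
  assume "deg K p < m"
  then show "\<forall>n\<ge>m. p n = \<zero>" using coeff_above_deg[OF assms(1)] by simp
qed

lemma lead_coeff_nonzero:
  assumes "p \<in> carrier R" "p \<noteq> \<zero>\<^bsub>R\<^esub>"
  shows "p (deg K p) \<noteq> \<zero>"
  using UP_ring.lcoeff_nonzero[OF UP_ring_K, of p] assms
  by (simp add: carrier_twisted_UP twisted_UP_zero UP_def)

lemma coeff_minus:
  assumes "p \<in> carrier R" "q \<in> carrier R"
  shows "(p \<ominus>\<^bsub>R\<^esub> q) n = p n \<ominus> q n"
proof -
  have "(p \<ominus>\<^bsub>R\<^esub> q) \<oplus>\<^bsub>R\<^esub> q = p"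
    using assms by (simp add: R.minus_eq R.a_assoc R.l_neg)
  moreover have "((p \<ominus>\<^bsub>R\<^esub> q) \<oplus>\<^bsub>R\<^esub> q) n = (p \<ominus>\<^bsub>R\<^esub> q) n \<oplus> q n"
    using assms R.minus_closed[of p q] twisted_UP_add[of "p \<ominus>\<^bsub>R\<^esub> q" K q] by (simp add: carrier_twisted_UP)
  ultimately have "p n = (p \<ominus>\<^bsub>R\<^esub> q) n \<oplus> q n" by simp
  moreover have "(p \<ominus>\<^bsub>R\<^esub> q) n \<in> carrier K" using assms by (intro coeff_in_K) simp
  ultimately show ?thesis using assms
    by (simp add: K.minus_eq K.a_assoc K.r_neg)
qed

lemma coeff_add: "p \<in> carrier R \<Longrightarrow> q \<in> carrier R \<Longrightarrow> (p \<oplus>\<^bsub>R\<^esub> q) n = p n \<oplus> q n"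
  by (simp add: carrier_twisted_UP twisted_UP_add)

lemma monom_eq: "a \<in> carrier K \<Longrightarrow> up_ring.monom (UP K) a d = (\<lambda>i. if i = d then a else \<zero>)"
  by (simp add: UP_def)

lemma monom_closed [simp]: "a \<in> carrier K \<Longrightarrow> up_ring.monom (UP K) a d \<in> carrier R"
  using upI[of "up_ring.monom (UP K) a d" d] by (simp add: carrier_twisted_UP monom_eq)

lemma deg_monom_less:
  assumes "a \<in> carrier K" "d < m"
  shows "deg K (up_ring.monom (UP K) a d) < m"
proof -
  have "0 < m" using assms by simp
  then show ?thesis
    unfolding deg_less_iff[OF monom_closed[OF assms(1)] \<open>0 < m\<close>] using assms by (simp add: monom_eq)
qed

lemma monom_mult_left:
  assumes a: "a \<in> carrier K" and p: "p \<in> carrier R"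
  shows "(up_ring.monom (UP K) a d \<otimes>\<^bsub>R\<^esub> p) n = (if d \<le> n then a \<otimes> (\<sigma> ^^ d) (p (n - d)) else \<zero>)"
proof -
  have "(up_ring.monom (UP K) a d \<otimes>\<^bsub>R\<^esub> p) n
      = (\<Oplus>i\<in>{..n}. if i = d then a \<otimes> (\<sigma> ^^ d) (p (n - d)) else \<zero>)"
    using a p monom_closed[OF a, of d]
    by (auto simp: twisted_UP_mult monom_eq carrier_twisted_UP coeff_closed intro!: finsum_cong')
  also have "\<dots> = (if d \<le> n then a \<otimes> (\<sigma> ^^ d) (p (n - d)) else \<zero>)"
  proof (cases "d \<le> n")
    case True
    then show ?thesis
      using a p finsum_singleton[of d "{..n}" "\<lambda>_. a \<otimes> (\<sigma> ^^ d) (p (n - d))"]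
      by (simp add: Pi_def eq_commute)
  next
    case False
    then have "(\<Oplus>i\<in>{..n}. if i = d then a \<otimes> (\<sigma> ^^ d) (p (n - d)) else \<zero>) = (\<Oplus>i\<in>{..n}. \<zero>)"
      by (intro finsum_cong') auto
    then show ?thesis using False by simp
  qed
  finally show ?thesis .
qed

lemma monom_mult_right:
  assumes a: "a \<in> carrier K" and p: "p \<in> carrier R"
  shows "(p \<otimes>\<^bsub>R\<^esub> up_ring.monom (UP K) a 0) n = p n \<otimes> (\<sigma> ^^ n) a"
proof -
  have "(p \<otimes>\<^bsub>R\<^esub> up_ring.monom (UP K) a 0) n = (\<Oplus>i\<in>{..n}. if n = i then p i \<otimes> (\<sigma> ^^ i) a else \<zero>)"
    using a p monom_closed[OF a, of 0]
    by (auto simp: twisted_UP_mult monom_eq carrier_twisted_UP coeff_closed intro!: finsum_cong')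
  also have "\<dots> = p n \<otimes> (\<sigma> ^^ n) a"
    using a p finsum_singleton[of n "{..n}" "\<lambda>i. p i \<otimes> (\<sigma> ^^ i) a"] by (simp add: Pi_def)
  finally show ?thesis .
qed

end

section \<open>Right division by a monic polynomial\<close>

locale monic_twisted_poly = twisted_poly +
  fixes f :: "nat \<Rightarrow> 'a"
  assumes f_closed [simp]: "f \<in> carrier (twisted_UP K \<sigma>)"
    and f_monic [simp]: "f (deg K f) = \<one>"
    and deg_f_pos [simp]: "0 < deg K f"
begin

abbreviation m where "m \<equiv> deg K f"

text \<open>
  The leading coefficient of \<open>q f\<close> is that of \<open>q\<close>, because \<open>\<sigma>\<close> preserves the leading
  coefficient \<open>1\<close> of \<open>f\<close>. So multiplication by \<open>f\<close> adds \<open>m\<close> to the degree, even in the presence of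
  zero divisors.
\<close>

lemma left_multiple_of_small_degree:
  assumes q: "q \<in> carrier R" and small: "deg K (q \<otimes>\<^bsub>R\<^esub> f) < m"
  shows "q = \<zero>\<^bsub>R\<^esub>"
proof (rule ccontr)
  assume "q \<noteq> \<zero>\<^bsub>R\<^esub>"
  then have "q (deg K q) \<noteq> \<zero>" using lead_coeff_nonzero q by blast
  moreover have "(q \<otimes>\<^bsub>R\<^esub> f) (deg K q + m) = q (deg K q) \<otimes> (\<sigma> ^^ deg K q) (f m)"
    using q f_closed by (intro mult_coeff_top) (auto simp: carrier_twisted_UP coeff_above_deg)
  moreover have "(q \<otimes>\<^bsub>R\<^esub> f) (deg K q + m) = \<zero>"
    using small q by (simp add: deg_less_iff)
  ultimately show False using q by simp
qed

text \<open>
  Long division: subtracting \<open>c t\<^sup>d f\<close> cancels the top coefficient \<open>c\<close> of \<open>g\<close>, again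
  because \<open>\<sigma>\<^sup>d(1) = 1\<close>.
\<close>

lemma right_division:
  assumes "g \<in> carrier R"
  obtains q r where "q \<in> carrier R" "r \<in> carrier R" "deg K r < m" "g = q \<otimes>\<^bsub>R\<^esub> f \<oplus>\<^bsub>R\<^esub> r"
proof -
  have small: "\<exists>q\<in>carrier R. \<exists>r\<in>carrier R. deg K r < m \<and> g = q \<otimes>\<^bsub>R\<^esub> f \<oplus>\<^bsub>R\<^esub> r"
    if "g \<in> carrier R" "deg K g < m" for g
    using that by (intro bexI[of _ "\<zero>\<^bsub>R\<^esub>"] bexI[of _ g]) simp_all
  have "\<exists>q\<in>carrier R. \<exists>r\<in>carrier R. deg K r < m \<and> g = q \<otimes>\<^bsub>R\<^esub> f \<oplus>\<^bsub>R\<^esub> r"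
    if "g \<in> carrier R" "\<And>k. k \<ge> n \<Longrightarrow> g k = \<zero>" for n g
    using that
  proof (induction n arbitrary: g)
    case 0
    then have "deg K g < m" unfolding deg_less_iff[OF 0(1) deg_f_pos] by simp
    then show ?case by (rule small[OF 0(1)])
  next
    case (Suc n)
    show ?case
    proof (cases "n < m")
      case True
      then have "deg K g < m" using Suc.prems by (simp add: deg_less_iff)
      then show ?thesis by (rule small[OF Suc.prems(1)])
    next
      case False
      let ?c = "up_ring.monom (UP K) (g n) (n - m)"
      have c: "?c \<in> carrier R" using Suc.prems by simp
      have cf: "?c \<otimes>\<^bsub>R\<^esub> f \<in> carrier R" using c by simp
      have "(g \<ominus>\<^bsub>R\<^esub> ?c \<otimes>\<^bsub>R\<^esub> f) k = \<zero>" if "k \<ge> n" for k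
      proof (cases "k = n")
        case True
        then show ?thesis
          using False Suc.prems cf by (simp add: coeff_minus monom_mult_left K.minus_eq K.r_neg)
      next
        case neq: False
        then have "(?c \<otimes>\<^bsub>R\<^esub> f) k = \<zero>"
          using False Suc.prems that by (simp add: monom_mult_left coeff_above_deg)
        then show ?thesis
          using neq that Suc.prems cf by (simp add: coeff_minus K.minus_eq)
      qed
      moreover have "g \<ominus>\<^bsub>R\<^esub> ?c \<otimes>\<^bsub>R\<^esub> f \<in> carrier R" using Suc.prems cf by simp
      ultimately obtain q r where q: "q \<in> carrier R" "r \<in> carrier R" "deg K r < m"
        and eq: "g \<ominus>\<^bsub>R\<^esub> ?c \<otimes>\<^bsub>R\<^esub> f = q \<otimes>\<^bsub>R\<^esub> f \<oplus>\<^bsub>R\<^esub> r"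
        using Suc.IH by blast
      have "g = (g \<ominus>\<^bsub>R\<^esub> ?c \<otimes>\<^bsub>R\<^esub> f) \<oplus>\<^bsub>R\<^esub> ?c \<otimes>\<^bsub>R\<^esub> f"
        using Suc.prems cf by (simp add: R.minus_eq R.a_assoc R.l_neg)
      also have "\<dots> = (q \<oplus>\<^bsub>R\<^esub> ?c) \<otimes>\<^bsub>R\<^esub> f \<oplus>\<^bsub>R\<^esub> r"
        unfolding eq using q c cf by (simp add: R.l_distr R.a_ac)
      finally have "g = (q \<oplus>\<^bsub>R\<^esub> ?c) \<otimes>\<^bsub>R\<^esub> f \<oplus>\<^bsub>R\<^esub> r" .
      then show ?thesis using q c by blast
    qed
  qed
  moreover have "\<And>k. k \<ge> Suc (deg K g) \<Longrightarrow> g k = \<zero>" using assms by (simp add: coeff_above_deg)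
  ultimately show ?thesis using assms that by blast
qed

lemma rmod_unique:
  assumes q: "q \<in> carrier R" and r: "r \<in> carrier R" "deg K r < m"
  shows "rmod K \<sigma> f (q \<otimes>\<^bsub>R\<^esub> f \<oplus>\<^bsub>R\<^esub> r) = r"
  unfolding rmod_def Let_def
proof (rule the_equality)
  show "r \<in> carrier R \<and> deg K r < m \<and>
      (\<exists>q'\<in>carrier R. q \<otimes>\<^bsub>R\<^esub> f \<oplus>\<^bsub>R\<^esub> r = q' \<otimes>\<^bsub>R\<^esub> f \<oplus>\<^bsub>R\<^esub> r)"
    using q r by blast
next
  fix r' assume "r' \<in> carrier R \<and> deg K r' < m \<and>
      (\<exists>q'\<in>carrier R. q \<otimes>\<^bsub>R\<^esub> f \<oplus>\<^bsub>R\<^esub> r = q' \<otimes>\<^bsub>R\<^esub> f \<oplus>\<^bsub>R\<^esub> r')"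
  then obtain q' where r': "r' \<in> carrier R" "deg K r' < m" and q': "q' \<in> carrier R"
    and eq: "q \<otimes>\<^bsub>R\<^esub> f \<oplus>\<^bsub>R\<^esub> r = q' \<otimes>\<^bsub>R\<^esub> f \<oplus>\<^bsub>R\<^esub> r'"
    by blast
  have qf: "q \<otimes>\<^bsub>R\<^esub> f \<in> carrier R" "q' \<otimes>\<^bsub>R\<^esub> f \<in> carrier R" using q q' by simp_all
  have "(q \<ominus>\<^bsub>R\<^esub> q') \<otimes>\<^bsub>R\<^esub> f = q \<otimes>\<^bsub>R\<^esub> f \<ominus>\<^bsub>R\<^esub> q' \<otimes>\<^bsub>R\<^esub> f"
    using q q' by (simp add: R.minus_eq R.l_distr R.l_minus)
  also have "\<dots> = (q \<otimes>\<^bsub>R\<^esub> f \<oplus>\<^bsub>R\<^esub> r) \<ominus>\<^bsub>R\<^esub> (q' \<otimes>\<^bsub>R\<^esub> f \<oplus>\<^bsub>R\<^esub> r)"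
    using qf r by (simp add: R.minus_eq R.minus_add R.a_ac R.r_neg R.r_neg1 R.r_neg2)
  also have "\<dots> = r' \<ominus>\<^bsub>R\<^esub> r"
    unfolding eq using qf r r' by (simp add: R.minus_eq R.minus_add R.a_ac R.r_neg R.r_neg1 R.r_neg2)
  finally have diff: "(q \<ominus>\<^bsub>R\<^esub> q') \<otimes>\<^bsub>R\<^esub> f = r' \<ominus>\<^bsub>R\<^esub> r" .
  have "deg K (r' \<ominus>\<^bsub>R\<^esub> r) < m"
    using r r' by (simp add: deg_less_iff coeff_minus K.minus_eq)
  then have "q \<ominus>\<^bsub>R\<^esub> q' = \<zero>\<^bsub>R\<^esub>"
    using q q' diff by (intro left_multiple_of_small_degree) simp_all
  then have "r' \<ominus>\<^bsub>R\<^esub> r = \<zero>\<^bsub>R\<^esub>" using diff by simp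
  then show "r' = r" using r r' by (simp add: R.r_right_minus_eq)
qed

lemma rmodE:
  assumes "g \<in> carrier R"
  obtains q where "q \<in> carrier R" "g = q \<otimes>\<^bsub>R\<^esub> f \<oplus>\<^bsub>R\<^esub> rmod K \<sigma> f g"
    and "rmod K \<sigma> f g \<in> carrier R" "deg K (rmod K \<sigma> f g) < m"
  using right_division[OF assms] rmod_unique by metis

lemma rmod_closed [simp]: "g \<in> carrier R \<Longrightarrow> rmod K \<sigma> f g \<in> carrier R"
  and deg_rmod [simp]: "g \<in> carrier R \<Longrightarrow> deg K (rmod K \<sigma> f g) < m"
  by (metis rmodE)+

lemma rmod_small: "g \<in> carrier R \<Longrightarrow> deg K g < m \<Longrightarrow> rmod K \<sigma> f g = g"
  using rmod_unique[of "\<zero>\<^bsub>R\<^esub>" g] by simp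

text \<open>
  Congruence modulo \<open>R f\<close> is stated as \<open>g + a f = h + b f\<close>: with a multiple of \<open>f\<close> on either side,
  no subtraction in \<open>R\<close> is needed when it is applied.
\<close>

lemma rmod_cong:
  assumes g: "g \<in> carrier R" "h \<in> carrier R" and ab: "a \<in> carrier R" "b \<in> carrier R"
    and eq: "g \<oplus>\<^bsub>R\<^esub> a \<otimes>\<^bsub>R\<^esub> f = h \<oplus>\<^bsub>R\<^esub> b \<otimes>\<^bsub>R\<^esub> f"
  shows "rmod K \<sigma> f g = rmod K \<sigma> f h"
proof -
  obtain q where q: "q \<in> carrier R" and h: "h = q \<otimes>\<^bsub>R\<^esub> f \<oplus>\<^bsub>R\<^esub> rmod K \<sigma> f h"
    using rmodE g by metis
  let ?r = "rmod K \<sigma> f h"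
  have r: "?r \<in> carrier R" "deg K ?r < m" using g by simp_all
  have cl: "a \<otimes>\<^bsub>R\<^esub> f \<in> carrier R" "b \<otimes>\<^bsub>R\<^esub> f \<in> carrier R" "q \<otimes>\<^bsub>R\<^esub> f \<in> carrier R"
    using ab q by simp_all
  have "g = (g \<oplus>\<^bsub>R\<^esub> a \<otimes>\<^bsub>R\<^esub> f) \<ominus>\<^bsub>R\<^esub> a \<otimes>\<^bsub>R\<^esub> f"
    using g cl by (simp add: R.minus_eq R.a_assoc R.r_neg)
  also have "\<dots> = (q \<otimes>\<^bsub>R\<^esub> f \<oplus>\<^bsub>R\<^esub> ?r) \<oplus>\<^bsub>R\<^esub> b \<otimes>\<^bsub>R\<^esub> f \<ominus>\<^bsub>R\<^esub> a \<otimes>\<^bsub>R\<^esub> f"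
    using eq h by simp
  also have "\<dots> = (q \<oplus>\<^bsub>R\<^esub> b \<ominus>\<^bsub>R\<^esub> a) \<otimes>\<^bsub>R\<^esub> f \<oplus>\<^bsub>R\<^esub> ?r"
    using ab q r cl by (simp add: R.minus_eq R.l_distr R.l_minus R.a_ac)
  finally have "g = (q \<oplus>\<^bsub>R\<^esub> b \<ominus>\<^bsub>R\<^esub> a) \<otimes>\<^bsub>R\<^esub> f \<oplus>\<^bsub>R\<^esub> ?r" .
  then show ?thesis using rmod_unique[OF _ r] ab q by (metis R.a_closed R.minus_closed)
qed

lemma rmod_eqD:
  assumes "g \<in> carrier R" "h \<in> carrier R" "rmod K \<sigma> f g = rmod K \<sigma> f h"
  obtains a b where "a \<in> carrier R" "b \<in> carrier R" "g \<oplus>\<^bsub>R\<^esub> a \<otimes>\<^bsub>R\<^esub> f = h \<oplus>\<^bsub>R\<^esub> b \<otimes>\<^bsub>R\<^esub> f"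
proof -
  obtain q where q: "q \<in> carrier R" "g = q \<otimes>\<^bsub>R\<^esub> f \<oplus>\<^bsub>R\<^esub> rmod K \<sigma> f g" using rmodE assms by metis
  obtain q' where q': "q' \<in> carrier R" "h = q' \<otimes>\<^bsub>R\<^esub> f \<oplus>\<^bsub>R\<^esub> rmod K \<sigma> f h" using rmodE assms by metis
  let ?r = "rmod K \<sigma> f h"
  have "(q \<otimes>\<^bsub>R\<^esub> f \<oplus>\<^bsub>R\<^esub> ?r) \<oplus>\<^bsub>R\<^esub> q' \<otimes>\<^bsub>R\<^esub> f = (q' \<otimes>\<^bsub>R\<^esub> f \<oplus>\<^bsub>R\<^esub> ?r) \<oplus>\<^bsub>R\<^esub> q \<otimes>\<^bsub>R\<^esub> f"
    using q(1) q'(1) assms by (simp add: R.a_ac)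
  then have "g \<oplus>\<^bsub>R\<^esub> q' \<otimes>\<^bsub>R\<^esub> f = h \<oplus>\<^bsub>R\<^esub> q \<otimes>\<^bsub>R\<^esub> f" using q q' assms(3) by simp
  then show ?thesis using that q q' by blast
qed

end

section \<open>Nuclei of the Petit algebra\<close>

lemma petit_carrier: "carrier (petit_algebra K \<sigma> f) = {g \<in> carrier (twisted_UP K \<sigma>). deg K g < deg K f}"
  by (simp add: petit_algebra_def Let_def)

lemma petit_mult: "g \<otimes>\<^bsub>petit_algebra K \<sigma> f\<^esub> h = rmod K \<sigma> f (g \<otimes>\<^bsub>twisted_UP K \<sigma>\<^esub> h)"
  by (simp add: petit_algebra_def Let_def)

lemma petit_simps:
  "\<one>\<^bsub>petit_algebra K \<sigma> f\<^esub> = \<one>\<^bsub>twisted_UP K \<sigma>\<^esub>"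
  "\<zero>\<^bsub>petit_algebra K \<sigma> f\<^esub> = \<zero>\<^bsub>twisted_UP K \<sigma>\<^esub>"
  "g \<oplus>\<^bsub>petit_algebra K \<sigma> f\<^esub> h = g \<oplus>\<^bsub>twisted_UP K \<sigma>\<^esub> h"
  "a \<odot>\<^bsub>petit_algebra K \<sigma> f\<^esub> h = a \<odot>\<^bsub>twisted_UP K \<sigma>\<^esub> h"
  by (simp_all add: petit_algebra_def Let_def)

context monic_twisted_poly
begin

abbreviation S where "S \<equiv> petit_algebra K \<sigma> f"

text \<open>
  If \<open>f x \<in> R f\<close>, then right multiplication by \<open>x\<close> maps \<open>R f\<close> into itself. Hence reducing \<open>y z\<close>
  modulo \<open>f\<close> before multiplying by \<open>x\<close> does not change the result modulo \<open>f\<close>, and both bracketings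
  equal the remainder of \<open>y z x\<close>.
\<close>

lemma idealizer_imp_nuc_r:
  assumes x: "x \<in> carrier S" and fx: "f \<otimes>\<^bsub>R\<^esub> x = p \<otimes>\<^bsub>R\<^esub> f" and p: "p \<in> carrier R"
  shows "x \<in> nuc_r S"
proof -
  have xR: "x \<in> carrier R" using x by (simp add: petit_carrier)
  have "rmod K \<sigma> f (rmod K \<sigma> f (y \<otimes>\<^bsub>R\<^esub> z) \<otimes>\<^bsub>R\<^esub> x) = rmod K \<sigma> f (y \<otimes>\<^bsub>R\<^esub> rmod K \<sigma> f (z \<otimes>\<^bsub>R\<^esub> x))"
    if y: "y \<in> carrier R" and z: "z \<in> carrier R" for y z
  proof -
    define r s where "r = rmod K \<sigma> f (y \<otimes>\<^bsub>R\<^esub> z)" and "s = rmod K \<sigma> f (z \<otimes>\<^bsub>R\<^esub> x)"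
    have rs: "r \<in> carrier R" "s \<in> carrier R" using xR y z by (simp_all add: r_def s_def)
    obtain q where q: "q \<in> carrier R" "y \<otimes>\<^bsub>R\<^esub> z = q \<otimes>\<^bsub>R\<^esub> f \<oplus>\<^bsub>R\<^esub> r"
      using rmodE[of "y \<otimes>\<^bsub>R\<^esub> z"] y z unfolding r_def by auto
    obtain q' where q': "q' \<in> carrier R" "z \<otimes>\<^bsub>R\<^esub> x = q' \<otimes>\<^bsub>R\<^esub> f \<oplus>\<^bsub>R\<^esub> s"
      using rmodE[of "z \<otimes>\<^bsub>R\<^esub> x"] xR z unfolding s_def by auto
    have "r \<otimes>\<^bsub>R\<^esub> x \<oplus>\<^bsub>R\<^esub> (q \<otimes>\<^bsub>R\<^esub> p) \<otimes>\<^bsub>R\<^esub> f = r \<otimes>\<^bsub>R\<^esub> x \<oplus>\<^bsub>R\<^esub> q \<otimes>\<^bsub>R\<^esub> (f \<otimes>\<^bsub>R\<^esub> x)"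
      using q p by (simp add: fx R.m_assoc)
    also have "\<dots> = (q \<otimes>\<^bsub>R\<^esub> f \<oplus>\<^bsub>R\<^esub> r) \<otimes>\<^bsub>R\<^esub> x"
      using q rs xR by (simp add: R.l_distr R.a_comm R.m_assoc)
    also have "\<dots> = y \<otimes>\<^bsub>R\<^esub> (z \<otimes>\<^bsub>R\<^esub> x)"
      using y z xR by (simp add: q(2)[symmetric] R.m_assoc)
    also have "\<dots> = y \<otimes>\<^bsub>R\<^esub> s \<oplus>\<^bsub>R\<^esub> (y \<otimes>\<^bsub>R\<^esub> q') \<otimes>\<^bsub>R\<^esub> f"
      unfolding q'(2) using y q' rs by (simp add: R.r_distr R.a_comm R.m_assoc)
    finally have "rmod K \<sigma> f (r \<otimes>\<^bsub>R\<^esub> x) = rmod K \<sigma> f (y \<otimes>\<^bsub>R\<^esub> s)"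
      using rs xR y q q' p by (intro rmod_cong) simp_all
    then show ?thesis by (simp add: r_def s_def)
  qed
  then show ?thesis using x by (simp add: nuc_r_def petit_carrier petit_mult)
qed

text \<open>
  Conversely, one instance of the associative law suffices. With \<open>y = t\<^sup>m\<^sup>-\<^sup>1\<close> and \<open>z = t\<close>, which
  lie in \<open>S\<close> because \<open>m \<ge> 2\<close>, the product \<open>y z = t\<^sup>m\<close> is reduced by subtracting \<open>f\<close> exactly once.
  The two bracketings of \<open>y z x\<close> then differ by \<open>f x\<close> modulo \<open>R f\<close>, so \<open>f x\<close> must lie in \<open>R f\<close>.
\<close>

lemma nuc_r_imp_idealizer:
  assumes deg: "2 \<le> m" and x: "x \<in> nuc_r S"
  obtains p where "p \<in> carrier R" "f \<otimes>\<^bsub>R\<^esub> x = p \<otimes>\<^bsub>R\<^esub> f"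
proof -
  let ?t = "\<lambda>d. up_ring.monom (UP K) \<one> d"
  have xR: "x \<in> carrier R" using x by (simp add: nuc_r_def petit_carrier)
  have tR: "?t d \<in> carrier R" for d by simp
  have t_deg: "deg K (?t d) < m" if "d < m" for d
    using that by (simp add: deg_monom_less)
  have t_mult: "?t (m - 1) \<otimes>\<^bsub>R\<^esub> ?t 1 = ?t m"
  proof
    fix n
    show "(?t (m - 1) \<otimes>\<^bsub>R\<^esub> ?t 1) n = ?t m n"
      unfolding monom_mult_left[OF K.one_closed tR] using deg by (auto simp: monom_eq)
  qed
  define r where "r = ?t m \<ominus>\<^bsub>R\<^esub> f"
  have r: "r \<in> carrier R" "deg K r < m"
  proof -
    show rR: "r \<in> carrier R" using tR by (simp add: r_def)
    have r_coeff: "r n = ?t m n \<ominus> f n" for n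
      unfolding r_def by (rule coeff_minus[OF tR f_closed])
    have "r n = \<zero>" if "n \<ge> m" for n
      using that coeff_above_deg[OF f_closed, of n]
      by (cases "n = m") (simp_all add: r_coeff monom_eq K.minus_eq K.r_neg)
    then show "deg K r < m" using rR by (simp add: deg_less_iff)
  qed
  have tm: "?t m = f \<oplus>\<^bsub>R\<^esub> r"
    using tR by (simp add: r_def R.minus_eq R.a_lcomm[of f] R.r_neg)
  then have "rmod K \<sigma> f (?t m) = r"
    using rmod_unique[of "\<one>\<^bsub>R\<^esub>" r] r by simp
  moreover have "rmod K \<sigma> f (rmod K \<sigma> f (?t (m - 1) \<otimes>\<^bsub>R\<^esub> ?t 1) \<otimes>\<^bsub>R\<^esub> x)
      = rmod K \<sigma> f (?t (m - 1) \<otimes>\<^bsub>R\<^esub> rmod K \<sigma> f (?t 1 \<otimes>\<^bsub>R\<^esub> x))"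
    using x deg t_deg[of 1] t_deg[of "m - 1"] tR by (simp add: nuc_r_def petit_carrier petit_mult)
  ultimately have eq: "rmod K \<sigma> f (r \<otimes>\<^bsub>R\<^esub> x)
      = rmod K \<sigma> f (?t (m - 1) \<otimes>\<^bsub>R\<^esub> rmod K \<sigma> f (?t 1 \<otimes>\<^bsub>R\<^esub> x))"
    unfolding t_mult by simp
  define u s where "u = ?t (m - 1)" and "s = rmod K \<sigma> f (?t 1 \<otimes>\<^bsub>R\<^esub> x)"
  have us: "u \<in> carrier R" "s \<in> carrier R" using tR xR by (simp_all add: u_def s_def)
  obtain q where q: "q \<in> carrier R" "?t 1 \<otimes>\<^bsub>R\<^esub> x = q \<otimes>\<^bsub>R\<^esub> f \<oplus>\<^bsub>R\<^esub> s"
    using rmodE[of "?t 1 \<otimes>\<^bsub>R\<^esub> x"] tR xR unfolding s_def by auto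
  obtain a b where ab: "a \<in> carrier R" "b \<in> carrier R"
    and eq': "r \<otimes>\<^bsub>R\<^esub> x \<oplus>\<^bsub>R\<^esub> a \<otimes>\<^bsub>R\<^esub> f = u \<otimes>\<^bsub>R\<^esub> s \<oplus>\<^bsub>R\<^esub> b \<otimes>\<^bsub>R\<^esub> f"
    using rmod_eqD[OF _ _ eq[folded u_def s_def]] r us xR by auto
  have cl: "f \<otimes>\<^bsub>R\<^esub> x \<in> carrier R" "r \<otimes>\<^bsub>R\<^esub> x \<in> carrier R" "u \<otimes>\<^bsub>R\<^esub> s \<in> carrier R"
    "u \<otimes>\<^bsub>R\<^esub> q \<otimes>\<^bsub>R\<^esub> f \<in> carrier R" "a \<otimes>\<^bsub>R\<^esub> f \<in> carrier R" "b \<otimes>\<^bsub>R\<^esub> f \<in> carrier R"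
    using r us xR q ab by simp_all
  have "f \<otimes>\<^bsub>R\<^esub> x \<oplus>\<^bsub>R\<^esub> r \<otimes>\<^bsub>R\<^esub> x = u \<otimes>\<^bsub>R\<^esub> (?t 1 \<otimes>\<^bsub>R\<^esub> x)"
    using r xR tR us by (simp add: R.l_distr[symmetric] tm[symmetric] t_mult[symmetric] u_def R.m_assoc)
  also have "\<dots> = u \<otimes>\<^bsub>R\<^esub> q \<otimes>\<^bsub>R\<^esub> f \<oplus>\<^bsub>R\<^esub> u \<otimes>\<^bsub>R\<^esub> s"
    unfolding q(2) using us q by (simp add: R.r_distr R.m_assoc)
  finally have *: "f \<otimes>\<^bsub>R\<^esub> x \<oplus>\<^bsub>R\<^esub> r \<otimes>\<^bsub>R\<^esub> x = u \<otimes>\<^bsub>R\<^esub> q \<otimes>\<^bsub>R\<^esub> f \<oplus>\<^bsub>R\<^esub> u \<otimes>\<^bsub>R\<^esub> s" .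
  have "f \<otimes>\<^bsub>R\<^esub> x \<oplus>\<^bsub>R\<^esub> b \<otimes>\<^bsub>R\<^esub> f \<oplus>\<^bsub>R\<^esub> u \<otimes>\<^bsub>R\<^esub> s
      = (f \<otimes>\<^bsub>R\<^esub> x \<oplus>\<^bsub>R\<^esub> r \<otimes>\<^bsub>R\<^esub> x) \<oplus>\<^bsub>R\<^esub> a \<otimes>\<^bsub>R\<^esub> f"
    using cl eq' by (simp add: R.a_assoc R.a_comm[of "b \<otimes>\<^bsub>R\<^esub> f"])
  also have "\<dots> = u \<otimes>\<^bsub>R\<^esub> q \<otimes>\<^bsub>R\<^esub> f \<oplus>\<^bsub>R\<^esub> a \<otimes>\<^bsub>R\<^esub> f \<oplus>\<^bsub>R\<^esub> u \<otimes>\<^bsub>R\<^esub> s"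
    unfolding * using cl by (simp add: R.a_ac)
  finally have "f \<otimes>\<^bsub>R\<^esub> x \<oplus>\<^bsub>R\<^esub> b \<otimes>\<^bsub>R\<^esub> f = u \<otimes>\<^bsub>R\<^esub> q \<otimes>\<^bsub>R\<^esub> f \<oplus>\<^bsub>R\<^esub> a \<otimes>\<^bsub>R\<^esub> f"
    using cl by simp
  then have "f \<otimes>\<^bsub>R\<^esub> x = u \<otimes>\<^bsub>R\<^esub> q \<otimes>\<^bsub>R\<^esub> f \<oplus>\<^bsub>R\<^esub> a \<otimes>\<^bsub>R\<^esub> f \<ominus>\<^bsub>R\<^esub> b \<otimes>\<^bsub>R\<^esub> f"
    using cl by (metis R.a_assoc R.a_inv_closed R.minus_eq R.r_neg R.r_zero)
  also have "\<dots> = (u \<otimes>\<^bsub>R\<^esub> q \<oplus>\<^bsub>R\<^esub> a \<ominus>\<^bsub>R\<^esub> b) \<otimes>\<^bsub>R\<^esub> f"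
    using us q ab by (simp add: R.minus_eq R.l_distr R.l_minus)
  finally show ?thesis using that us q ab by (metis R.a_closed R.m_closed R.minus_closed)
qed

text \<open>
  Multiplying by a constant does not raise the degree, so the products \<open>a y\<close> and \<open>y a\<close> are not
  reduced. Only the right nucleus imposes a condition on constants.
\<close>

lemma constant_in_nuc_l_nuc_m:
  assumes a: "a \<in> carrier K"
  shows "up_ring.monom (UP K) a 0 \<in> nuc_l S \<inter> nuc_m S"
proof -
  let ?a = "up_ring.monom (UP K) a 0"
  have aR: "?a \<in> carrier R" using a by simp
  have aS: "?a \<in> carrier S" using a by (simp add: petit_carrier deg_monom_less)
  have l: "rmod K \<sigma> f (?a \<otimes>\<^bsub>R\<^esub> y) = ?a \<otimes>\<^bsub>R\<^esub> y" if "y \<in> carrier S" for y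
    using that aR a by (intro rmod_small) (auto simp: petit_carrier deg_less_iff monom_mult_left)
  have r: "rmod K \<sigma> f (y \<otimes>\<^bsub>R\<^esub> ?a) = y \<otimes>\<^bsub>R\<^esub> ?a" if "y \<in> carrier S" for y
    using that aR a by (intro rmod_small) (auto simp: petit_carrier deg_less_iff monom_mult_right)
  have "rmod K \<sigma> f (?a \<otimes>\<^bsub>R\<^esub> y \<otimes>\<^bsub>R\<^esub> z) = rmod K \<sigma> f (?a \<otimes>\<^bsub>R\<^esub> rmod K \<sigma> f (y \<otimes>\<^bsub>R\<^esub> z))"
    if y: "y \<in> carrier R" and z: "z \<in> carrier R" for y z
  proof -
    let ?r = "rmod K \<sigma> f (y \<otimes>\<^bsub>R\<^esub> z)"
    obtain q where q: "q \<in> carrier R" "y \<otimes>\<^bsub>R\<^esub> z = q \<otimes>\<^bsub>R\<^esub> f \<oplus>\<^bsub>R\<^esub> ?r"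
      using rmodE[of "y \<otimes>\<^bsub>R\<^esub> z"] y z by auto
    have rR: "?r \<in> carrier R" using y z by simp
    have "?a \<otimes>\<^bsub>R\<^esub> y \<otimes>\<^bsub>R\<^esub> z = ?a \<otimes>\<^bsub>R\<^esub> (q \<otimes>\<^bsub>R\<^esub> f \<oplus>\<^bsub>R\<^esub> ?r)"
      using y z aR by (simp add: q(2)[symmetric] R.m_assoc)
    also have "\<dots> = ?a \<otimes>\<^bsub>R\<^esub> ?r \<oplus>\<^bsub>R\<^esub> (?a \<otimes>\<^bsub>R\<^esub> q) \<otimes>\<^bsub>R\<^esub> f"
      using q(1) aR rR by (simp add: R.r_distr R.a_comm R.m_assoc)
    finally show ?thesis
      using y z aR rR q(1) by (intro rmod_cong[of _ _ "\<zero>\<^bsub>R\<^esub>" "?a \<otimes>\<^bsub>R\<^esub> q"]) simp_all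
  qed
  then have "?a \<in> nuc_l S"
    using aS l by (simp add: nuc_l_def petit_mult) (simp add: petit_carrier)
  moreover have "?a \<in> nuc_m S"
    using aS aR l r by (simp add: nuc_m_def petit_mult) (simp add: petit_carrier R.m_assoc)
  ultimately show ?thesis by simp
qed

text \<open>
  By the above, \<open>a\<close> belongs to the nucleus if and only if \<open>f a = p f\<close> for some \<open>p\<close>. Both
  \<open>f a\<close> and \<open>\<sigma>\<^sup>m(a) f\<close> have \<open>\<sigma>\<^sup>m(a)\<close> in degree \<open>m\<close> and nothing above, which forces \<open>p = \<sigma>\<^sup>m(a)\<close>.
  The remaining coefficients give the stated conditions.
\<close>

lemma nuc_field_eq:
  assumes deg: "2 \<le> m"
  shows "nuc_field K \<sigma> f = {a \<in> carrier K. \<forall>i. f i \<otimes> (\<sigma> ^^ i) a = (\<sigma> ^^ m) a \<otimes> f i}"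
proof (intro equalityI subsetI)
  let ?c = "\<lambda>a. up_ring.monom (UP K) a 0"
  fix a assume "a \<in> nuc_field K \<sigma> f"
  then have a: "a \<in> carrier K" and "?c a \<in> nuc_r S"
    by (simp_all add: nuc_field_def nuc_def)
  then obtain p where p: "p \<in> carrier R" and fp: "f \<otimes>\<^bsub>R\<^esub> ?c a = p \<otimes>\<^bsub>R\<^esub> f"
    using nuc_r_imp_idealizer[OF deg] by blast
  let ?b = "?c ((\<sigma> ^^ m) a)"
  have cR: "?c a \<in> carrier R" "?b \<in> carrier R" using a by simp_all
  have "(p \<ominus>\<^bsub>R\<^esub> ?b) \<otimes>\<^bsub>R\<^esub> f = f \<otimes>\<^bsub>R\<^esub> ?c a \<ominus>\<^bsub>R\<^esub> ?b \<otimes>\<^bsub>R\<^esub> f"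
    using p cR by (simp add: R.minus_eq R.l_distr R.l_minus fp)
  moreover have "(f \<otimes>\<^bsub>R\<^esub> ?c a \<ominus>\<^bsub>R\<^esub> ?b \<otimes>\<^bsub>R\<^esub> f) n = \<zero>" if "n \<ge> m" for n
    using that a cR
    by (cases "n = m")
      (simp_all add: coeff_minus monom_mult_left monom_mult_right coeff_above_deg K.minus_eq K.r_neg)
  ultimately have "deg K ((p \<ominus>\<^bsub>R\<^esub> ?b) \<otimes>\<^bsub>R\<^esub> f) < m"
    using p cR by (simp add: deg_less_iff)
  then have "p \<ominus>\<^bsub>R\<^esub> ?b = \<zero>\<^bsub>R\<^esub>"
    using p cR by (intro left_multiple_of_small_degree) simp_all
  then have "p = ?b" using p cR by (simp add: R.r_right_minus_eq)
  then have "(f \<otimes>\<^bsub>R\<^esub> ?c a) i = (?b \<otimes>\<^bsub>R\<^esub> f) i" for i using fp by simp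
  then show "a \<in> {a \<in> carrier K. \<forall>i. f i \<otimes> (\<sigma> ^^ i) a = (\<sigma> ^^ m) a \<otimes> f i}"
    using a by (simp add: monom_mult_left monom_mult_right)
next
  let ?c = "\<lambda>a. up_ring.monom (UP K) a 0"
  fix a assume "a \<in> {a \<in> carrier K. \<forall>i. f i \<otimes> (\<sigma> ^^ i) a = (\<sigma> ^^ m) a \<otimes> f i}"
  then have a: "a \<in> carrier K" and comm: "\<And>i. f i \<otimes> (\<sigma> ^^ i) a = (\<sigma> ^^ m) a \<otimes> f i"
    by simp_all
  have "f \<otimes>\<^bsub>R\<^esub> ?c a = ?c ((\<sigma> ^^ m) a) \<otimes>\<^bsub>R\<^esub> f"
  proof
    fix i
    show "(f \<otimes>\<^bsub>R\<^esub> ?c a) i = (?c ((\<sigma> ^^ m) a) \<otimes>\<^bsub>R\<^esub> f) i"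
      using a comm by (simp add: monom_mult_left monom_mult_right)
  qed
  moreover have "?c a \<in> carrier S"
    using constant_in_nuc_l_nuc_m[OF a] by (simp add: nuc_l_def)
  ultimately have "?c a \<in> nuc_r S"
    using idealizer_imp_nuc_r[of "?c a" "?c ((\<sigma> ^^ m) a)"] a by simp
  then show "a \<in> nuc_field K \<sigma> f"
    using constant_in_nuc_l_nuc_m[OF a] a by (simp add: nuc_field_def nuc_def)
qed

text \<open>
  The identity \<open>f x = x' f\<close>, where \<open>x'\<close> is obtained by applying \<open>\<sigma>\<^sup>m\<close> to the coefficients of \<open>x\<close>.
  The nucleus condition turns the convolution for \<open>f x\<close> into \<open>\<Sum> \<sigma>\<^sup>m(x\<^sub>n\<^sub>-\<^sub>i) f\<^sub>i\<close>. Since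
  \<open>\<sigma>\<close> fixes the coefficients of \<open>f\<close>, the convolution for \<open>x' f\<close> is the same sum read backwards.
\<close>

lemma semicommute_with_f:
  assumes x: "x \<in> carrier R"
    and comm: "\<And>i j. f i \<otimes> (\<sigma> ^^ i) (x j) = (\<sigma> ^^ m) (x j) \<otimes> f i"
    and fixed: "\<And>i j. (\<sigma> ^^ i) (f j) = f j"
  shows "f \<otimes>\<^bsub>R\<^esub> x = (\<lambda>j. (\<sigma> ^^ m) (x j)) \<otimes>\<^bsub>R\<^esub> f"
    and "(\<lambda>j. (\<sigma> ^^ m) (x j)) \<in> carrier R"
proof -
  have [simp]: "x j \<in> carrier K" "f j \<in> carrier K" for j using x by simp_all
  show y: "(\<lambda>j. (\<sigma> ^^ m) (x j)) \<in> carrier R"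
    using upI[of "\<lambda>j. (\<sigma> ^^ m) (x j)" "deg K x"] x by (simp add: carrier_twisted_UP coeff_above_deg)
  show "f \<otimes>\<^bsub>R\<^esub> x = (\<lambda>j. (\<sigma> ^^ m) (x j)) \<otimes>\<^bsub>R\<^esub> f"
  proof
    fix n
    have "(f \<otimes>\<^bsub>R\<^esub> x) n = (\<Oplus>i\<in>{..n}. (\<sigma> ^^ m) (x (n - i)) \<otimes> f i)"
      using x f_closed by (simp add: carrier_twisted_UP twisted_UP_mult comm)
    also have "\<dots> = (\<Oplus>i\<in>(\<lambda>i. n - i) ` {..n}. (\<sigma> ^^ m) (x (n - i)) \<otimes> f i)"
      by (rule arg_cong[where f = "finsum K _"]) (auto simp: image_iff intro: diff_diff_cancel[symmetric])
    also have "\<dots> = (\<Oplus>i\<in>{..n}. (\<sigma> ^^ m) (x (n - (n - i))) \<otimes> f (n - i))"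
      by (rule finsum_reindex) (auto simp: inj_on_def)
    also have "\<dots> = ((\<lambda>j. (\<sigma> ^^ m) (x j)) \<otimes>\<^bsub>R\<^esub> f) n"
      using x f_closed y by (auto simp: carrier_twisted_UP twisted_UP_mult fixed intro!: finsum_cong')
    finally show "(f \<otimes>\<^bsub>R\<^esub> x) n = ((\<lambda>j. (\<sigma> ^^ m) (x j)) \<otimes>\<^bsub>R\<^esub> f) n" .
  qed
qed

end

section \<open>Petit algebras over an invariant subring\<close>

locale twisted_subring = twisted_poly +
  fixes N :: "'a set"
  assumes subring_N: "subring N K"
    and twist_N: "a \<in> N \<Longrightarrow> \<sigma> a \<in> N"
begin

abbreviation KN where "KN \<equiv> K\<lparr>carrier := N\<rparr>"
abbreviation \<tau> where "\<tau> \<equiv> restrict \<sigma> N"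

lemma N_subset: "a \<in> N \<Longrightarrow> a \<in> carrier K"
  using subringE(1)[OF subring_N] by blast

lemma twist_pow_N [simp]: "a \<in> N \<Longrightarrow> (\<sigma> ^^ i) a \<in> N"
  by (induction i) (simp_all add: twist_N)

lemma restrict_twist_pow: "a \<in> N \<Longrightarrow> (\<tau> ^^ i) a = (\<sigma> ^^ i) a"
  by (induction i) simp_all

lemma ring_KN: "ring KN"
  using subring_is_ring[OF subring_N] .

lemma twisted_poly_N: "twisted_poly KN \<tau>"
proof (intro twisted_poly.intro ring_KN twisted_poly_axioms.intro ring_hom_memI)
qed (auto simp: twist_N N_subset ring_hom_mult[OF twist_hom] ring_hom_add[OF twist_hom]
    ring_hom_one[OF twist_hom] subringE(3,6,7)[OF subring_N])

sublocale Sub: twisted_poly KN \<tau>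
  by (rule twisted_poly_N)

lemma finsum_N:
  assumes "finite A" "g \<in> A \<rightarrow> N"
  shows "finsum KN g A = finsum K g A"
  using assms
proof (induction A rule: finite_induct)
  case (insert x A)
  then have "g \<in> A \<rightarrow> carrier K" "g x \<in> carrier K" by (auto intro: N_subset)
  then show ?case using insert by (simp add: Sub.finsum_insert)
qed simp

lemma carrier_RN: "carrier Sub.R = {p \<in> carrier R. \<forall>n. p n \<in> N}"
  unfolding carrier_twisted_UP up_def by (auto simp: Pi_def N_subset)

lemma RN_subset: "p \<in> carrier Sub.R \<Longrightarrow> p \<in> carrier R"
  by (simp add: carrier_RN)

lemma deg_N: "p \<in> carrier Sub.R \<Longrightarrow> deg KN p = deg K p"
  using RN_subset[of p] by (simp add: deg_def coeff_UP Sub.coeff_UP)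

lemma add_N: "p \<in> carrier Sub.R \<Longrightarrow> q \<in> carrier Sub.R \<Longrightarrow> p \<oplus>\<^bsub>Sub.R\<^esub> q = p \<oplus>\<^bsub>R\<^esub> q"
  using RN_subset[of p] RN_subset[of q] by (simp add: carrier_twisted_UP twisted_UP_add)

lemma mult_N:
  assumes p: "p \<in> carrier Sub.R" and q: "q \<in> carrier Sub.R"
  shows "p \<otimes>\<^bsub>Sub.R\<^esub> q = p \<otimes>\<^bsub>R\<^esub> q"
proof
  fix n
  have pq: "p i \<in> N" "q i \<in> N" for i using p q by (simp_all add: carrier_RN)
  have "(p \<otimes>\<^bsub>Sub.R\<^esub> q) n = (\<Oplus>\<^bsub>KN\<^esub>i\<in>{..n}. p i \<otimes> (\<sigma> ^^ i) (q (n - i)))"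
    using p q pq by (simp add: carrier_twisted_UP twisted_UP_mult restrict_twist_pow)
  also have "\<dots> = (\<Oplus>i\<in>{..n}. p i \<otimes> (\<sigma> ^^ i) (q (n - i)))"
    using pq subringE(6)[OF subring_N] by (intro finsum_N) auto
  also have "\<dots> = (p \<otimes>\<^bsub>R\<^esub> q) n"
    using RN_subset[OF p] RN_subset[OF q] by (simp add: carrier_twisted_UP twisted_UP_mult)
  finally show "(p \<otimes>\<^bsub>Sub.R\<^esub> q) n = (p \<otimes>\<^bsub>R\<^esub> q) n" .
qed

end

locale monic_twisted_subring = twisted_subring + monic_twisted_poly +
  assumes f_N: "f n \<in> N"
begin

lemma f_RN: "f \<in> carrier Sub.R"
  using f_closed by (simp add: carrier_RN f_N)

sublocale Sub: monic_twisted_poly KN \<tau> f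
  by unfold_locales (use deg_f_pos in \<open>simp_all add: f_RN deg_N\<close>)

text \<open>
  Division by \<open>f\<close> inside \<open>N[t;\<sigma>]\<close> is also a division in \<open>K[t;\<sigma>]\<close>, where remainders are unique.
\<close>

lemma rmod_N:
  assumes "g \<in> carrier Sub.R"
  shows "rmod KN \<tau> f g = rmod K \<sigma> f g"
proof -
  obtain q where q: "q \<in> carrier Sub.R"
    and eq: "g = q \<otimes>\<^bsub>Sub.R\<^esub> f \<oplus>\<^bsub>Sub.R\<^esub> rmod KN \<tau> f g"
    and r: "rmod KN \<tau> f g \<in> carrier Sub.R" "deg KN (rmod KN \<tau> f g) < deg KN f"
    using Sub.rmodE[OF assms] .
  have "q \<otimes>\<^bsub>Sub.R\<^esub> f \<in> carrier Sub.R" using q f_RN by (intro Sub.R.m_closed)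
  then have "g = q \<otimes>\<^bsub>R\<^esub> f \<oplus>\<^bsub>R\<^esub> rmod KN \<tau> f g"
    using eq r q f_RN by (simp add: add_N mult_N)
  then show ?thesis
    using rmod_unique[of q "rmod KN \<tau> f g"] q r f_RN RN_subset by (simp add: deg_N)
qed

lemma petit_carrier_N: "carrier Sub.S = {g \<in> carrier Sub.R. deg K g < m}"
proof -
  have "deg KN f = m" using f_RN by (rule deg_N)
  then show ?thesis by (auto simp: petit_carrier deg_N)
qed

lemma petit_mult_N:
  assumes "g \<in> carrier Sub.S" "h \<in> carrier Sub.S"
  shows "g \<otimes>\<^bsub>Sub.S\<^esub> h = g \<otimes>\<^bsub>S\<^esub> h"
  using assms Sub.R.m_closed[of g h] by (simp add: petit_carrier_N petit_mult mult_N rmod_N)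

lemma petit_N_subset: "carrier Sub.S \<subseteq> carrier S"
  unfolding petit_carrier_N by (auto simp: petit_carrier RN_subset)

lemma petit_mult_N_closed:
  assumes "g \<in> carrier Sub.S" "h \<in> carrier Sub.S"
  shows "g \<otimes>\<^bsub>Sub.S\<^esub> h \<in> carrier Sub.S"
proof -
  have "g \<otimes>\<^bsub>Sub.R\<^esub> h \<in> carrier Sub.R"
    using assms by (intro Sub.R.m_closed) (simp_all add: petit_carrier)
  then show ?thesis
    using Sub.rmod_closed Sub.deg_rmod unfolding petit_carrier petit_mult by blast
qed

text \<open>
  For \<open>T\<close> the right nucleus of \<open>S\<close> is meant. All closure properties come from \<open>N[t;\<sigma>]\<close> being a ring;
  what \<open>T\<close> contributes is only that it lies between the two Petit algebras.
\<close>

lemma petit_N_subalgebra: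
  assumes F: "F \<subseteq> N" and T: "carrier Sub.S \<subseteq> T" "T \<subseteq> carrier S"
  shows "is_subalgebra (K\<lparr>carrier := F\<rparr>) Sub.S (S\<lparr>carrier := T\<rparr>)"
proof -
  let ?C = "carrier Sub.S"
  have zero: "\<zero>\<^bsub>Sub.R\<^esub> = \<zero>\<^bsub>R\<^esub>" and one: "\<one>\<^bsub>Sub.R\<^esub> = \<one>\<^bsub>R\<^esub>"
    by (simp_all add: twisted_UP_zero twisted_UP_one fun_eq_iff)
  have C: "x \<in> carrier Sub.R" "x \<in> carrier R" if "x \<in> ?C" for x
    using that by (simp_all add: petit_carrier_N RN_subset)
  have C_iff: "x \<in> ?C \<longleftrightarrow> x \<in> carrier Sub.R \<and> (\<forall>n\<ge>m. x n = \<zero>)" for x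
    using RN_subset[of x] by (auto simp: petit_carrier_N deg_less_iff)
  have add: "x \<oplus>\<^bsub>R\<^esub> y \<in> ?C" if "x \<in> ?C" "y \<in> ?C" for x y
    using that Sub.R.a_closed[of x y] RN_subset[of x] RN_subset[of y]
    by (simp add: C_iff add_N coeff_add)
  \<comment> \<open>Additive inverses are taken in \<open>N[t;\<sigma>]\<close>, which makes their coefficients lie in \<open>N\<close>.\<close>
  have neg: "\<exists>y\<in>?C. x \<oplus>\<^bsub>R\<^esub> y = \<zero>\<^bsub>R\<^esub>" if x: "x \<in> ?C" for x
  proof -
    have y: "\<ominus>\<^bsub>Sub.R\<^esub> x \<in> carrier Sub.R" using C[OF x] by simp
    have eq: "x \<oplus>\<^bsub>R\<^esub> \<ominus>\<^bsub>Sub.R\<^esub> x = \<zero>\<^bsub>R\<^esub>"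
      using C[OF x] y by (simp add: add_N[symmetric] Sub.R.r_neg zero)
    have "(\<ominus>\<^bsub>Sub.R\<^esub> x) n = \<zero>" if "n \<ge> m" for n
    proof -
      have "x n \<oplus> (\<ominus>\<^bsub>Sub.R\<^esub> x) n = \<zero>"
        using eq C[OF x] RN_subset[OF y] by (metis twisted_UP_zero coeff_add)
      then show ?thesis using x that RN_subset[OF y] by (simp add: C_iff)
    qed
    then show ?thesis using eq y C_iff by blast
  qed
  have "submodule ?C (K\<lparr>carrier := F\<rparr>) (S\<lparr>carrier := T\<rparr>)"
  proof (intro submodule.intro submodule_axioms.intro subgroup.intro)
    show "?C \<subseteq> carrier (add_monoid (S\<lparr>carrier := T\<rparr>))" using T by simp
    show "\<one>\<^bsub>add_monoid (S\<lparr>carrier := T\<rparr>)\<^esub> \<in> ?C"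
      using Sub.R.zero_closed by (simp add: petit_simps C_iff zero) (simp add: twisted_UP_zero)
    fix x assume x: "x \<in> ?C"
    show "x \<otimes>\<^bsub>add_monoid (S\<lparr>carrier := T\<rparr>)\<^esub> y \<in> ?C" if "y \<in> ?C" for y
      using x that add by (simp add: petit_simps)
    obtain y where y: "y \<in> ?C" "x \<oplus>\<^bsub>R\<^esub> y = \<zero>\<^bsub>R\<^esub>" using neg[OF x] by blast
    have "m_inv (add_monoid (S\<lparr>carrier := T\<rparr>)) x = y"
      \<comment> \<open>The inverse is by definition the only one within \<open>T\<close>; uniqueness is inherited from \<open>R\<close>.\<close>
      unfolding m_inv_def
    proof (rule the_equality)
      show "y \<in> carrier (add_monoid (S\<lparr>carrier := T\<rparr>)) \<and>
          x \<otimes>\<^bsub>add_monoid (S\<lparr>carrier := T\<rparr>)\<^esub> y = \<one>\<^bsub>add_monoid (S\<lparr>carrier := T\<rparr>)\<^esub> \<and>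
          y \<otimes>\<^bsub>add_monoid (S\<lparr>carrier := T\<rparr>)\<^esub> x = \<one>\<^bsub>add_monoid (S\<lparr>carrier := T\<rparr>)\<^esub>"
        using y T x C by (auto simp: petit_simps R.a_comm)
      fix z assume "z \<in> carrier (add_monoid (S\<lparr>carrier := T\<rparr>)) \<and>
          x \<otimes>\<^bsub>add_monoid (S\<lparr>carrier := T\<rparr>)\<^esub> z = \<one>\<^bsub>add_monoid (S\<lparr>carrier := T\<rparr>)\<^esub> \<and>
          z \<otimes>\<^bsub>add_monoid (S\<lparr>carrier := T\<rparr>)\<^esub> x = \<one>\<^bsub>add_monoid (S\<lparr>carrier := T\<rparr>)\<^esub>"
      then have "z \<in> carrier R" "x \<oplus>\<^bsub>R\<^esub> z = x \<oplus>\<^bsub>R\<^esub> y"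
        using T y by (auto simp: petit_simps petit_carrier)
      then show "z = y" using C(2)[OF x] C(2)[OF y(1)] R.add.l_cancel by metis
    qed
    then show "inv\<^bsub>add_monoid (S\<lparr>carrier := T\<rparr>)\<^esub> x \<in> ?C" using y by simp
  next
    fix a x assume a: "a \<in> carrier (K\<lparr>carrier := F\<rparr>)" and x: "x \<in> ?C"
    then have aN: "a \<in> N" "a \<in> carrier K" using F N_subset by auto
    \<comment> \<open>Writing the scalar as a constant polynomial over \<open>N\<close> shows that the coefficients stay in \<open>N\<close>.\<close>
    have "a \<odot>\<^bsub>R\<^esub> x = up_ring.monom (UP KN) a 0 \<otimes>\<^bsub>Sub.R\<^esub> x"
    proof
      fix n
      show "(a \<odot>\<^bsub>R\<^esub> x) n = (up_ring.monom (UP KN) a 0 \<otimes>\<^bsub>Sub.R\<^esub> x) n"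
        using aN C[OF x] by (simp add: Sub.monom_mult_left) (simp add: carrier_twisted_UP twisted_UP_smult)
    qed
    moreover have "up_ring.monom (UP KN) a 0 \<otimes>\<^bsub>Sub.R\<^esub> x \<in> carrier Sub.R"
      using aN C[OF x] by simp
    moreover have "(a \<odot>\<^bsub>R\<^esub> x) n = \<zero>" if "n \<ge> m" for n
      using that x aN C[OF x] by (simp add: C_iff carrier_twisted_UP twisted_UP_smult)
    ultimately show "a \<odot>\<^bsub>S\<lparr>carrier := T\<rparr>\<^esub> x \<in> ?C"
      by (simp add: petit_simps C_iff)
  qed
  moreover have "\<one>\<^bsub>R\<^esub> \<in> ?C"
  proof -
    have "\<one>\<^bsub>R\<^esub> n = \<zero>" if "n \<ge> m" for n
    proof -
      have "n \<noteq> 0" using that deg_f_pos by linarith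
      then show ?thesis by (simp add: twisted_UP_one)
    qed
    then show ?thesis using Sub.R.one_closed unfolding C_iff one by blast
  qed
  moreover have "a \<odot>\<^bsub>Sub.S\<^esub> x = a \<odot>\<^bsub>S\<^esub> x" if "a \<in> F" "x \<in> ?C" for a x
    using that F C[OF that(2)] N_subset[of a] by (auto simp: petit_simps carrier_twisted_UP twisted_UP_smult)
  ultimately show ?thesis
    unfolding is_subalgebra_def
    using petit_mult_N petit_mult_N_closed add_N C by (auto simp: petit_simps zero one)
qed

end

section \<open>The nucleus as a field of coefficients\<close>

lemma (in twisted_poly) subfield_twist_pow_agree:
  assumes "field K"
  shows "subfield {a \<in> carrier K. \<forall>i\<in>I. (\<sigma> ^^ i) a = (\<sigma> ^^ m) a} K"
proof -
  interpret field K by fact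
  show ?thesis
  proof (rule subfieldI')
    show "subring {a \<in> carrier K. \<forall>i\<in>I. (\<sigma> ^^ i) a = (\<sigma> ^^ m) a} K"
    proof (rule subringI)
      fix a assume a: "a \<in> {a \<in> carrier K. \<forall>i\<in>I. (\<sigma> ^^ i) a = (\<sigma> ^^ m) a}"
      have "(\<sigma> ^^ j) (\<ominus> a) = \<ominus> (\<sigma> ^^ j) a" for j
        using a minus_equality[of "(\<sigma> ^^ j) (\<ominus> a)" "(\<sigma> ^^ j) a"]
        by (simp add: twist_pow_add[symmetric] l_neg)
      then show "\<ominus> a \<in> {a \<in> carrier K. \<forall>i\<in>I. (\<sigma> ^^ i) a = (\<sigma> ^^ m) a}"
        using a by simp
    qed (auto simp: twist_pow_mult twist_pow_add)
  next
    fix a assume a: "a \<in> {a \<in> carrier K. \<forall>i\<in>I. (\<sigma> ^^ i) a = (\<sigma> ^^ m) a} - {\<zero>}"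
    then have unit: "a \<in> Units K" by (simp add: field_Units)
    then have inv: "inv a \<in> carrier K" "inv a \<otimes> a = \<one>" by simp_all
    have "inv ((\<sigma> ^^ j) a) = (\<sigma> ^^ j) (inv a)" for j
    proof (rule comm_inv_char)
      show "(\<sigma> ^^ j) a \<in> carrier K" "(\<sigma> ^^ j) (inv a) \<in> carrier K" using a inv by auto
      have "(\<sigma> ^^ j) (a \<otimes> inv a) = (\<sigma> ^^ j) a \<otimes> (\<sigma> ^^ j) (inv a)"
        using a inv by (intro twist_pow_mult) auto
      then show "(\<sigma> ^^ j) a \<otimes> (\<sigma> ^^ j) (inv a) = \<one>" using unit by simp
    qed
    then have "(\<sigma> ^^ i) (inv a) = (\<sigma> ^^ m) (inv a)" if "i \<in> I" for i
      using a that by (metis (mono_tags, lifting) DiffD1 mem_Collect_eq)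
    then show "inv a \<in> {a \<in> carrier K. \<forall>i\<in>I. (\<sigma> ^^ i) a = (\<sigma> ^^ m) a}"
      using inv by simp
  qed
qed

theorem theorem10:
  fixes K :: "('a, 'b) ring_scheme" and \<sigma> :: "'a \<Rightarrow> 'a" and f :: "nat \<Rightarrow> 'a"
  defines "F \<equiv> Fix K \<sigma>"
    and "S \<equiv> petit_algebra K \<sigma> f"
    and "N \<equiv> nuc_field K \<sigma> f"
  defines "S\<^sub>N \<equiv> petit_algebra (K\<lparr>carrier := N\<rparr>) (restrict \<sigma> N) f"
  assumes "field K"
    and "\<sigma> \<in> ring_iso K K"
    and "f \<in> carrier (twisted_UP K \<sigma>)"
    and "coeff (UP K) f (deg K f) = \<one>\<^bsub>K\<^esub>"
    and "2 \<le> deg K f"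
    and "\<not> right_invariant K \<sigma> f"
    and "f \<in> carrier (UP (K\<lparr>carrier := F\<rparr>))"
  shows "petit_data (K\<lparr>carrier := N\<rparr>) (restrict \<sigma> N) f \<and>
    is_subalgebra (K\<lparr>carrier := F\<rparr>) S\<^sub>N (S\<lparr>carrier := nuc_r S\<rparr>) \<and>
    is_associative S\<^sub>N"
proof -
  interpret field K by fact
  have bij: "bij_betw \<sigma> (carrier K) (carrier K)" and hom: "\<sigma> \<in> ring_hom K K"
    using \<open>\<sigma> \<in> ring_iso K K\<close> by (simp_all add: ring_iso_def)
  interpret twisted_poly K \<sigma> by unfold_locales (rule hom)
  have lead: "f (deg K f) = \<one>\<^bsub>K\<^esub>"
    using assms(7,8) by (simp add: coeff_UP)
  interpret monic_twisted_poly K \<sigma> f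
    by unfold_locales (use assms(7,9) lead in auto)
  have f_K [simp]: "f i \<in> carrier K" for i by simp
  have f_F: "f i \<in> F" for i
    using assms(11) mem_upD[of f "K\<lparr>carrier := F\<rparr>" i] by (simp add: UP_def)
  have F_fixed: "(\<sigma> ^^ i) a = a" if "a \<in> F" for a i
    using that by (induction i) (simp_all add: F_def Fix_def)
  have N_comm: "N = {a \<in> carrier K. \<forall>i. f i \<otimes>\<^bsub>K\<^esub> (\<sigma> ^^ i) a = (\<sigma> ^^ deg K f) a \<otimes>\<^bsub>K\<^esub> f i}"
    unfolding N_def by (rule nuc_field_eq) (rule assms(9))
  have "f i \<otimes>\<^bsub>K\<^esub> (\<sigma> ^^ i) a = (\<sigma> ^^ deg K f) a \<otimes>\<^bsub>K\<^esub> f i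
      \<longleftrightarrow> f i = \<zero>\<^bsub>K\<^esub> \<or> (\<sigma> ^^ i) a = (\<sigma> ^^ deg K f) a" if "a \<in> carrier K" for a i
    using that m_comm[of "(\<sigma> ^^ deg K f) a" "f i"] m_lcancel[of "f i" "(\<sigma> ^^ i) a" "(\<sigma> ^^ deg K f) a"]
    by (cases "f i = \<zero>\<^bsub>K\<^esub>") simp_all
  then have N_agree:
    "N = {a \<in> carrier K. \<forall>i\<in>{i. f i \<noteq> \<zero>\<^bsub>K\<^esub>}. (\<sigma> ^^ i) a = (\<sigma> ^^ deg K f) a}"
    unfolding N_comm by auto
  have subfield: "subfield N K"
    unfolding N_agree by (rule subfield_twist_pow_agree) fact
  \<comment> \<open>By injectivity of \<open>\<sigma>\<close> the conditions that define \<open>N\<close> are invariant under \<open>\<sigma>\<close> in both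
  directions, so that \<open>\<sigma>\<close> restricts to an automorphism of \<open>N\<close> and not just to an endomorphism.\<close>
  have twist_in_N_iff: "\<sigma> a \<in> N \<longleftrightarrow> a \<in> N" if a: "a \<in> carrier K" for a
  proof -
    have "(\<sigma> ^^ i) (\<sigma> a) = (\<sigma> ^^ deg K f) (\<sigma> a) \<longleftrightarrow> (\<sigma> ^^ i) a = (\<sigma> ^^ deg K f) a" for i
      using a bij inj_on_eq_iff[of \<sigma> "carrier K" "(\<sigma> ^^ i) a" "(\<sigma> ^^ deg K f) a"]
      by (simp add: bij_betw_def funpow_swap1[symmetric])
    then show ?thesis
      unfolding N_agree using a ring_hom_closed[OF hom a] by simp
  qed
  have F_N: "F \<subseteq> N"
    unfolding N_agree using F_fixed by (auto simp: F_def Fix_def)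
  have "monic_twisted_subring K \<sigma> N f"
  proof (intro monic_twisted_subring.intro twisted_subring.intro twisted_subring_axioms.intro
      monic_twisted_subring_axioms.intro twisted_poly_axioms monic_twisted_poly_axioms)
    show "subring N K" using subfieldE(1)[OF subfield] .
    then have "N \<subseteq> carrier K" by (rule subringE(1))
    then show "\<sigma> a \<in> N" if "a \<in> N" for a using that twist_in_N_iff by blast
    show "f n \<in> N" for n using f_F F_N by blast
  qed
  then interpret monic_twisted_subring K \<sigma> N f .
  have data: "petit_data (K\<lparr>carrier := N\<rparr>) (restrict \<sigma> N) f"
    unfolding petit_data_def
  proof (intro conjI)
    show "field (K\<lparr>carrier := N\<rparr>)" using subfield_iff(2)[OF subfield] .
    have "\<sigma> ` N = N"
    proof (intro equalityI subsetI)
      fix b assume b: "b \<in> N"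
      then obtain a where "a \<in> carrier K" "\<sigma> a = b"
        using bij N_subset by (metis bij_betw_imp_surj_on imageE)
      then show "b \<in> \<sigma> ` N" using b twist_in_N_iff by blast
    qed (auto simp: twist_N)
    moreover have "inj_on \<sigma> N"
      using bij by (auto simp: bij_betw_def intro: inj_on_subset N_subset)
    ultimately have "bij_betw (restrict \<sigma> N) N N"
      by (simp add: bij_betw_def inj_on_restrict_eq)
    then show "restrict \<sigma> N \<in> ring_iso (K\<lparr>carrier := N\<rparr>) (K\<lparr>carrier := N\<rparr>)"
      using Sub.twist_hom by (simp add: ring_iso_def)
    show "f \<in> carrier (twisted_UP (K\<lparr>carrier := N\<rparr>) (restrict \<sigma> N))" by (rule f_RN)
    show "up_ring.coeff (UP (K\<lparr>carrier := N\<rparr>)) f (deg (K\<lparr>carrier := N\<rparr>) f) = \<one>\<^bsub>K\<lparr>carrier := N\<rparr>\<^esub>"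
      using Sub.coeff_UP[OF f_RN] Sub.f_monic by simp
    show "2 \<le> deg (K\<lparr>carrier := N\<rparr>) f" using deg_N[OF f_RN] assms(9) by simp
  qed
  have nuc: "carrier S\<^sub>N \<subseteq> nuc_r S"
  proof
    fix x assume x: "x \<in> carrier S\<^sub>N"
    then have xN: "x j \<in> N" and xR: "x \<in> carrier (twisted_UP K \<sigma>)" for j
      by (simp_all add: S\<^sub>N_def petit_carrier_N carrier_RN)
    have "f i \<otimes>\<^bsub>K\<^esub> (\<sigma> ^^ i) (x j) = (\<sigma> ^^ deg K f) (x j) \<otimes>\<^bsub>K\<^esub> f i" for i j
      using xN unfolding N_comm by simp
    note semicommute = semicommute_with_f[OF xR this F_fixed[OF f_F]]
    show "x \<in> nuc_r S"
      unfolding S_def using x petit_N_subset semicommute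
      by (intro idealizer_imp_nuc_r[of x "\<lambda>j. (\<sigma> ^^ deg K f) (x j)"]) (auto simp: S\<^sub>N_def)
  qed
  have sub: "is_subalgebra (K\<lparr>carrier := F\<rparr>) S\<^sub>N (S\<lparr>carrier := nuc_r S\<rparr>)"
    unfolding S\<^sub>N_def S_def
    using F_N nuc by (intro petit_N_subalgebra) (auto simp: S\<^sub>N_def S_def nuc_r_def)
  have "is_associative S\<^sub>N"
    unfolding is_associative_def
  proof (intro ballI)
    fix x y z assume xyz: "x \<in> carrier S\<^sub>N" "y \<in> carrier S\<^sub>N" "z \<in> carrier S\<^sub>N"
    have "z \<in> nuc_r S" "x \<in> carrier S" "y \<in> carrier S"
      using xyz nuc petit_N_subset unfolding S\<^sub>N_def S_def by auto
    then have "(x \<otimes>\<^bsub>S\<^esub> y) \<otimes>\<^bsub>S\<^esub> z = x \<otimes>\<^bsub>S\<^esub> (y \<otimes>\<^bsub>S\<^esub> z)" by (simp add: nuc_r_def)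
    then show "(x \<otimes>\<^bsub>S\<^sub>N\<^esub> y) \<otimes>\<^bsub>S\<^sub>N\<^esub> z = x \<otimes>\<^bsub>S\<^sub>N\<^esub> (y \<otimes>\<^bsub>S\<^sub>N\<^esub> z)"
      using xyz petit_mult_N petit_mult_N_closed unfolding S\<^sub>N_def S_def by metis
  qed
  then show ?thesis using data sub by blast
qed

end
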